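(* Let $\Gamma$ be a strongly walk-regular graph, i.e. a graph that is strongly $\ell$-walk-regular for some integer $\ell>1$. Then $\Gamma$ belongs to at least one of the following families: (1) empty graphs; (2) complete graphs; (3) strongly regular graphs; (4) disjoint unions of complete bipartite graphs of the same size and isolated vertices; (5) regular graphs with exactly four distinct eigenvalues. Moreover, every graph in the families (1), (2), (3) is strongly $\ell$-walk-regular for every integer $\ell>1$, and every graph in family (4) is strongly $\ell$-walk-regular for every odd integer $\ell>1$.
   Context: Graphs are finite, simple and undirected, with at least one vertex. For an integer $\ell>1$, a graph $\Gamma$ is strongly $\ell$-walk-regular with parameters $(\lambda_\ell,\mu_\ell,\nu_\ell)$ if the number of walks of length $\ell$ between two vertices is $\lambda_\ell$ for every two adjacent vertices, $\mu_\ell$ for every two distinct non-adjacent vertices, and $\nu_\ell$ for every two identical vertices (i.e. from each vertex to itself). It is strongly $\ell$-walk-regular if this holds for some $\lambda_\ell,\mu_\ell,\nu_\ell$ (a parameter is arbitrary if there are no pairs of the corresponding type). An empty graph is a graph with no edges. A strongly regular graph is a regular graph (not necessarily connected) in which the number of common neighbors of two distinct vertices depends only on whether these vertices are adjacent or not. In family (4), the complete bipartite graphs all have the same number of edges ("size" means number of edges; their bipartition sizes may differ), and the number of isolated vertices may be zero. Eigenvalues of a graph are the eigenvalues of its adjacency matrix. *)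

theory Defs
  imports "Graph_Theory.Kuratowski" "Jordan_Normal_Form.Spectral_Radius"
begin

text \<open>
  A finite simple undirected graph is a digraph satisfying the locale predicate \<^const>\<open>graph\<close>:
  finite, symmetric, without loops and without parallel arcs. Every undirected edge is
  represented by two opposite arcs.
\<close>

definition num_walks :: "('a, 'b) pre_digraph \<Rightarrow> nat \<Rightarrow> 'a \<Rightarrow> 'a \<Rightarrow> nat" where
  "num_walks G l u v = card {p. pre_digraph.awalk G u p v \<and> length p = l}"

definition strongly_walk_regular_with ::
  "nat \<Rightarrow> nat \<Rightarrow> nat \<Rightarrow> nat \<Rightarrow> ('a, 'b) pre_digraph \<Rightarrow> bool" where
  "strongly_walk_regular_with l lam mu nu G \<longleftrightarrow> l > 1 \<and>
     (\<forall>u\<in>verts G. \<forall>v\<in>verts G.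
        (u \<rightarrow>\<^bsub>G\<^esub> v \<longrightarrow> num_walks G l u v = lam) \<and>
        (u \<noteq> v \<and> \<not> u \<rightarrow>\<^bsub>G\<^esub> v \<longrightarrow> num_walks G l u v = mu) \<and>
        (u = v \<longrightarrow> num_walks G l u v = nu))"

definition strongly_walk_regular :: "nat \<Rightarrow> ('a, 'b) pre_digraph \<Rightarrow> bool" where
  "strongly_walk_regular l G \<longleftrightarrow> (\<exists>lam mu nu. strongly_walk_regular_with l lam mu nu G)"

definition empty_graph :: "('a, 'b) pre_digraph \<Rightarrow> bool" where
  "empty_graph G \<longleftrightarrow> graph G \<and> arcs G = {}"

definition complete_graph :: "('a, 'b) pre_digraph \<Rightarrow> bool" where
  "complete_graph G \<longleftrightarrow> (\<exists>n. complete_digraph n G)"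

definition regular_graph :: "('a, 'b) pre_digraph \<Rightarrow> bool" where
  "regular_graph G \<longleftrightarrow> graph G \<and> (\<exists>k. \<forall>v\<in>verts G. out_degree G v = k)"

definition common_neighbors :: "('a, 'b) pre_digraph \<Rightarrow> 'a \<Rightarrow> 'a \<Rightarrow> 'a set" where
  "common_neighbors G u v = {w \<in> verts G. u \<rightarrow>\<^bsub>G\<^esub> w \<and> v \<rightarrow>\<^bsub>G\<^esub> w}"

text \<open>Connectedness is not required, and complete and empty graphs are not excluded.\<close>

definition strongly_regular :: "('a, 'b) pre_digraph \<Rightarrow> bool" where
  "strongly_regular G \<longleftrightarrow> regular_graph G \<and>
     (\<exists>a c. \<forall>u\<in>verts G. \<forall>v\<in>verts G. u \<noteq> v \<longrightarrow>
        card (common_neighbors G u v) = (if u \<rightarrow>\<^bsub>G\<^esub> v then a else c))"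

definition edges :: "('a, 'b) pre_digraph \<Rightarrow> 'a set set" where
  "edges G = {{u, v} | u v. u \<rightarrow>\<^bsub>G\<^esub> v}"

text \<open>Both colour classes of a complete bipartite graph are required to be nonempty.\<close>

definition complete_bipartite :: "('a, 'b) pre_digraph \<Rightarrow> bool" where
  "complete_bipartite G \<longleftrightarrow> (\<exists>m>0. \<exists>n>0. complete_bipartite_digraph m n G)"

definition isolated_vertex :: "('a, 'b) pre_digraph \<Rightarrow> bool" where
  "isolated_vertex G \<longleftrightarrow> card (verts G) = 1 \<and> arcs G = {}"

definition disjoint_union_of :: "('a, 'b) pre_digraph \<Rightarrow> ('a, 'b) pre_digraph set \<Rightarrow> bool" where
  "disjoint_union_of G HH \<longleftrightarrow>
     (\<forall>H\<in>HH. subgraph H G) \<and>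
     (\<forall>H\<in>HH. \<forall>K\<in>HH. H \<noteq> K \<longrightarrow> verts H \<inter> verts K = {}) \<and>
     verts G = (\<Union>H\<in>HH. verts H) \<and> arcs G = (\<Union>H\<in>HH. arcs H)"

definition union_of_equal_size_complete_bipartite :: "('a, 'b) pre_digraph \<Rightarrow> bool" where
  "union_of_equal_size_complete_bipartite G \<longleftrightarrow> graph G \<and>
     (\<exists>HH s. disjoint_union_of G HH \<and>
        (\<forall>H\<in>HH. (complete_bipartite H \<and> card (edges H) = s) \<or> isolated_vertex H))"

text \<open>
  The adjacency matrix is taken with respect to an enumeration of the vertices without
  repetitions. Changing the enumeration conjugates the matrix by a permutation matrix, so all
  enumerations yield the same eigenvalues.
\<close>

definition adjacency_matrix :: "('a, 'b) pre_digraph \<Rightarrow> 'a list \<Rightarrow> real mat" where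
  "adjacency_matrix G vs =
     mat (length vs) (length vs) (\<lambda>(i, j). if vs ! i \<rightarrow>\<^bsub>G\<^esub> vs ! j then 1 else 0)"

definition graph_eigenvalues :: "('a, 'b) pre_digraph \<Rightarrow> real set" where
  "graph_eigenvalues G =
     {x. \<exists>vs. distinct vs \<and> set vs = verts G \<and> eigenvalue (adjacency_matrix G vs) x}"

definition regular_with_four_eigenvalues :: "('a, 'b) pre_digraph \<Rightarrow> bool" where
  "regular_with_four_eigenvalues G \<longleftrightarrow> regular_graph G \<and> card (graph_eigenvalues G) = 4"

end

theory Submission
  imports Defs
begin

text \<open>
  Let $A$ be the adjacency matrix, so that $A^l + (\<mu>-\<lambda>) A + (\<mu>-\<nu>) I = \<mu> J$.

  If $\<mu> = 0$, then walks of length $j \<le> l$ with $j \<equiv> l$ modulo 2 extend to length $l$ and hence join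
  only equal or adjacent vertices. For even $l$, or for odd $l$ and $\<nu> > 0$, this makes every
  component complete, and $(d+1)\<lambda> = d^l - (-1)^l$ forces all degrees $d$ to agree. For odd $l$ and
  $\<nu> = 0$, every walk of length 3 is closed up by an edge, so the components are complete
  bipartite, with $\<lambda> = (mn)^{(l-1)/2}$ determining the number $mn$ of edges.

  If $\<mu> > 0$, then $J$ is a polynomial in $A$, so that $AJ = JA$ and the graph is regular, of degree
  $k$ say. All eigenvalues other than $k$ are roots of the trinomial, which has at most three real
  roots by Rolle's theorem. If there are at most three eigenvalues in total, then a quadratic
  polynomial in $A$ annihilates the orthogonal complement of the all-ones vector and is therefore a
  multiple of $J$, which is strong regularity.
\<close>

section \<open>Walk counts\<close>

text \<open>The combinatorial and spectral arguments run over a bare adjacency relation; arcs return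
  only once \<open>graph\<close> is made an instance.\<close>

locale simple_graph =
  fixes V :: "'a set" and adj :: "'a \<Rightarrow> 'a \<Rightarrow> bool"
  assumes finite_V: "finite V"
    and adj_in_V: "adj u v \<Longrightarrow> u \<in> V"
    and adj_sym: "adj u v \<Longrightarrow> adj v u"
    and adj_irrefl: "\<not> adj u u"
begin

definition nbs :: "'a \<Rightarrow> 'a set" where
  "nbs u = {v. adj u v}"

definition deg :: "'a \<Rightarrow> nat" where
  "deg u = card (nbs u)"

fun walks :: "nat \<Rightarrow> 'a \<Rightarrow> 'a \<Rightarrow> nat" where
  "walks 0 u v = (if u = v then 1 else 0)"
| "walks (Suc l) u v = (\<Sum>w\<in>nbs u. walks l w v)"

definition swr :: "nat \<Rightarrow> nat \<Rightarrow> nat \<Rightarrow> nat \<Rightarrow> bool" where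
  "swr l lam mu nu \<longleftrightarrow>
     (\<forall>u\<in>V. \<forall>v\<in>V. walks l u v = (if u = v then nu else if adj u v then lam else mu))"

definition srg :: bool where
  "srg \<longleftrightarrow> (\<exists>k a c. (\<forall>u\<in>V. deg u = k) \<and>
     (\<forall>u\<in>V. \<forall>v\<in>V. u \<noteq> v \<longrightarrow> card (nbs u \<inter> nbs v) = (if adj u v then a else c)))"

definition clique_union :: bool where
  "clique_union \<longleftrightarrow> (\<forall>u v w. adj u v \<longrightarrow> adj v w \<longrightarrow> u \<noteq> w \<longrightarrow> adj u w)"

text \<open>
  Since there are no loops, \<open>P4_closed\<close> says that every component is complete bipartite or a
  single vertex.
\<close>

definition P4_closed :: bool where
  "P4_closed \<longleftrightarrow> (\<forall>u x v w. adj u x \<longrightarrow> adj x v \<longrightarrow> adj v w \<longrightarrow> adj u w)"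

text \<open>The two ends of an edge of K_{m,n} have degrees m and n, so the product is the number of
  edges of the component.\<close>

definition biclique_union :: "nat \<Rightarrow> bool" where
  "biclique_union s \<longleftrightarrow> P4_closed \<and> (\<forall>u v. adj u v \<longrightarrow> deg u * deg v = s)"

lemma clique_unionD: "clique_union \<Longrightarrow> adj u v \<Longrightarrow> adj v w \<Longrightarrow> u \<noteq> w \<Longrightarrow> adj u w"
  unfolding clique_union_def by blast

lemma P4_closedD: "P4_closed \<Longrightarrow> adj u x \<Longrightarrow> adj x v \<Longrightarrow> adj v w \<Longrightarrow> adj u w"
  unfolding P4_closed_def by blast

lemma adj_in_V2: "adj u v \<Longrightarrow> v \<in> V"
  using adj_in_V adj_sym by blast

lemma adj_commute: "adj u v \<longleftrightarrow> adj v u"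
  using adj_sym by blast

lemma in_nbs [simp]: "v \<in> nbs u \<longleftrightarrow> adj u v"
  by (simp add: nbs_def)

lemma nbs_subset_V: "nbs u \<subseteq> V"
  using adj_in_V2 by auto

lemma finite_nbs [simp]: "finite (nbs u)"
  using finite_subset[OF nbs_subset_V finite_V] .

lemma deg_pos: "adj u v \<Longrightarrow> deg u > 0"
  by (auto simp: deg_def card_gt_0_iff)

lemma sum_nbs:
  fixes f :: "'a \<Rightarrow> 'b::semiring_1"
  shows "(\<Sum>w\<in>nbs u. f w) = (\<Sum>w\<in>V. (if adj u w then f w else 0))"
proof -
  have "nbs u = {w \<in> V. adj u w}"
    using adj_in_V2 by auto
  then show ?thesis
    by (simp add: sum.inter_filter finite_V)
qed

lemma walks_Suc_right: "walks (Suc l) u v = (\<Sum>w\<in>nbs v. walks l u w)"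
proof (induction l arbitrary: u)
  case 0
  show ?case
    by (simp add: adj_commute)
next
  case (Suc l)
  have "walks (Suc (Suc l)) u v = (\<Sum>x\<in>nbs u. walks (Suc l) x v)"
    by simp
  also have "\<dots> = (\<Sum>x\<in>nbs u. \<Sum>w\<in>nbs v. walks l x w)"
    by (simp only: Suc)
  also have "\<dots> = (\<Sum>w\<in>nbs v. walks (Suc l) u w)"
    by (simp only: walks.simps(2)) (rule sum.swap)
  finally show ?case .
qed

lemma walks_sym: "walks l u v = walks l v u"
proof (induction l arbitrary: u v)
  case (Suc l)
  have "walks (Suc l) u v = (\<Sum>w\<in>nbs u. walks l v w)"
    using Suc by simp
  then show ?case
    by (simp only: walks_Suc_right)
qed simp

lemma walks_Suc_pos: "walks (Suc l) u v > 0 \<longleftrightarrow> (\<exists>w. adj u w \<and> walks l w v > 0)"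
  by (auto simp del: neq0_conv simp add: neq0_conv[symmetric])

text \<open>A walk of positive length leaves \<open>u\<close> along some edge; going back and forth
  along it beforehand adds two steps.\<close>

lemma walks_pos_pad:
  assumes "walks (Suc l) u v > 0"
  shows "walks (Suc l + 2 * m) u v > 0"
proof (induction m)
  case (Suc m)
  obtain w where "adj u w"
    using assms walks_Suc_pos by blast
  then have "walks (Suc (Suc (Suc l + 2 * m))) u v > 0"
    using Suc adj_sym walks_Suc_pos by blast
  then show ?case by simp
qed (use assms in simp)

lemma walks_pos_pad':
  assumes "walks j u v > 0" "0 < j" "j \<le> l" "even (l - j)"
  shows "walks l u v > 0"
proof -
  obtain m where "l - j = 2 * m" using assms(4) by blast
  then have "l = Suc (j - 1) + 2 * m" using assms by simp
  then show ?thesis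
    using walks_pos_pad[of "j - 1" u v m] assms by simp
qed

lemma walks_1_pos: "walks (Suc 0) u v > 0 \<longleftrightarrow> adj u v"
  by simp

lemma walks_2_pos: "adj u x \<Longrightarrow> adj x v \<Longrightarrow> walks 2 u v > 0"
  using walks_Suc_pos walks_1_pos by (metis numeral_2_eq_2)

lemma walks_3_pos: "adj u x \<Longrightarrow> adj x w \<Longrightarrow> adj w v \<Longrightarrow> walks 3 u v > 0"
  using walks_Suc_pos walks_2_pos by (metis numeral_3_eq_3 numeral_2_eq_2)

text \<open>This is entry (u, v) of A (x I + y A + z (J - I - A)). The subtraction on naturals never
  truncates, since it computes \<open>card R\<close>, the number of neighbours of \<open>u\<close>
  that are neither \<open>v\<close> nor adjacent to \<open>v\<close>.\<close>

lemma sum_nbs_by_type: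
  fixes x y z :: nat
  shows "(\<Sum>w\<in>nbs u. (if w = v then x else if adj w v then y else z)) =
    (if adj u v then x else 0) + card (nbs u \<inter> nbs v) * y
    + (deg u - card (nbs u \<inter> nbs v) - (if adj u v then 1 else 0)) * z"
proof -
  define R where "R = nbs u - nbs v - {v}"
  have *: "nbs u = (nbs u \<inter> {v}) \<union> ((nbs u \<inter> nbs v) \<union> R)"
    unfolding R_def by auto
  have d: "(nbs u \<inter> {v}) \<inter> ((nbs u \<inter> nbs v) \<union> R) = {}" "(nbs u \<inter> nbs v) \<inter> R = {}"
    unfolding R_def using adj_irrefl by auto
  have fin: "finite R" "finite (nbs u \<inter> nbs v)" "finite (nbs u \<inter> {v})"
    unfolding R_def by auto
  have iv: "nbs u \<inter> {v} = (if adj u v then {v} else {})"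
    by auto
  have c: "deg u = (if adj u v then 1 else 0) + (card (nbs u \<inter> nbs v) + card R)"
    unfolding deg_def
    by (subst *, subst card_Un_disjoint) (use d fin iv in \<open>auto simp: card_Un_disjoint\<close>)
  have s1: "(\<Sum>w\<in>nbs u \<inter> {v}. (if w = v then x else if adj w v then y else z))
      = (if adj u v then x else 0)"
    using iv by simp
  have s2: "(\<Sum>w\<in>nbs u \<inter> nbs v. (if w = v then x else if adj w v then y else z))
      = card (nbs u \<inter> nbs v) * y"
  proof -
    have "(\<Sum>w\<in>nbs u \<inter> nbs v. (if w = v then x else if adj w v then y else z))
       = (\<Sum>w\<in>nbs u \<inter> nbs v. y)"
      using adj_irrefl adj_sym by (intro sum.cong) auto
    then show ?thesis by simp
  qed
  have s3: "(\<Sum>w\<in>R. (if w = v then x else if adj w v then y else z)) = card R * z"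
  proof -
    have "(\<Sum>w\<in>R. (if w = v then x else if adj w v then y else z)) = (\<Sum>w\<in>R. z)"
      unfolding R_def using adj_sym by (intro sum.cong) auto
    then show ?thesis by simp
  qed
  have "(\<Sum>w\<in>nbs u. (if w = v then x else if adj w v then y else z))
    = (\<Sum>w\<in>nbs u \<inter> {v}. (if w = v then x else if adj w v then y else z))
    + ((\<Sum>w\<in>nbs u \<inter> nbs v. (if w = v then x else if adj w v then y else z))
    + (\<Sum>w\<in>R. (if w = v then x else if adj w v then y else z)))"
    by (subst *) (use d fin in \<open>simp add: sum.union_disjoint\<close>)
  then show ?thesis
    unfolding s1 s2 s3 using c by simp
qed

text \<open>For a strongly regular graph the span of I, A and J - I - A is closed under
  multiplication by A, so all powers of A stay in it.\<close>

lemma srg_imp_swr: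
  assumes "srg"
  shows "\<exists>lam mu nu. swr l lam mu nu"
proof (induction l)
  case 0
  show ?case
    by (intro exI[of _ 0] exI[of _ 1]) (auto simp: swr_def)
next
  case (Suc l)
  obtain k a c where k: "\<forall>u\<in>V. deg u = k"
    and ac: "\<forall>u\<in>V. \<forall>v\<in>V. u \<noteq> v \<longrightarrow> card (nbs u \<inter> nbs v) = (if adj u v then a else c)"
    using assms unfolding srg_def by blast
  obtain lam mu nu where s: "swr l lam mu nu"
    using Suc by blast
  have *: "walks (Suc l) u v = (if adj u v then nu else 0) + card (nbs u \<inter> nbs v) * lam
    + (deg u - card (nbs u \<inter> nbs v) - (if adj u v then 1 else 0)) * mu"
    if "u \<in> V" "v \<in> V" for u v
  proof -
    have "walks (Suc l) u v = (\<Sum>w\<in>nbs u. (if w = v then nu else if adj w v then lam else mu))"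
      using s that adj_in_V2 by (simp add: swr_def)
    then show ?thesis
      by (simp only: sum_nbs_by_type)
  qed
  \<comment> \<open>The parameters are read off from \<open>*\<close> with \<open>a\<close>,
    \<open>c\<close> or, on the diagonal, \<open>k\<close> common neighbours; in the last case the
    coefficient of \<open>mu\<close> vanishes.\<close>
  have "swr (Suc l) (nu + a * lam + (k - a - 1) * mu) (c * lam + (k - c) * mu) (k * lam)"
    unfolding swr_def
  proof (intro ballI)
    fix u v assume "u \<in> V" "v \<in> V"
    then show "walks (Suc l) u v = (if u = v then k * lam else if adj u v
      then nu + a * lam + (k - a - 1) * mu else c * lam + (k - c) * mu)"
      unfolding *[OF \<open>u \<in> V\<close> \<open>v \<in> V\<close>]
      using k ac adj_irrefl by (auto simp: deg_def)
  qed
  then show ?case by blast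
qed

text \<open>Peel off two steps \<open>u\<close>, \<open>x\<close>, \<open>y\<close>. If
  \<open>u\<close> and \<open>v\<close> are adjacent, every \<open>x\<close> has neighbourhood
  \<open>nbs v\<close>, so there are \<open>deg u * deg v\<close> choices, and \<open>y\<close> is
  again adjacent to \<open>v\<close> and has the degree of \<open>u\<close>.\<close>

lemma P4_closed_walks:
  assumes "P4_closed"
  shows "walks (2 * m + 1) u v = (if adj u v then (deg u * deg v) ^ m else 0)"
proof (induction m arbitrary: u)
  case 0
  then show ?case by simp
next
  note P = P4_closedD[OF assms]
  case (Suc m)
  have *: "walks (2 * Suc m + 1) u v = (\<Sum>x\<in>nbs u. \<Sum>y\<in>nbs x. walks (2 * m + 1) y v)"
    by simp
  show ?case
  proof (cases "adj u v")
    case True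
    have "nbs x = nbs v" if "x \<in> nbs u" for x
    proof (rule Set.set_eqI)
      fix z
      show "z \<in> nbs x \<longleftrightarrow> z \<in> nbs v"
        using P[of z x u v] P[of z v u x] that True adj_sym by (metis in_nbs)
    qed
    moreover have "deg y = deg u" if "y \<in> nbs v" for y
    proof -
      have "nbs y = nbs u"
      proof (rule Set.set_eqI)
        fix z
        show "z \<in> nbs y \<longleftrightarrow> z \<in> nbs u"
          using P[of z y v u] P[of z u v y] that True adj_sym by (metis in_nbs)
      qed
      then show ?thesis by (simp add: deg_def)
    qed
    ultimately have "walks (2 * Suc m + 1) u v = (\<Sum>x\<in>nbs u. \<Sum>y\<in>nbs v. (deg u * deg v) ^ m)"
      unfolding * Suc by (intro sum.cong refl) (auto simp: adj_commute)
    then show ?thesis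
      using True by (simp add: deg_def algebra_simps)
  next
    case False
    then have "walks (2 * m + 1) y v = 0" if "x \<in> nbs u" "y \<in> nbs x" for x y
      using that P[of u x y v] Suc[of y] by (auto simp del: walks.simps)
    then show ?thesis
      unfolding * using False by simp
  qed
qed

lemma biclique_union_imp_swr:
  assumes "biclique_union s" "odd l"
  shows "swr l (s ^ (l div 2)) 0 0"
proof -
  have P: "P4_closed"
    using assms(1) unfolding biclique_union_def by blast
  have "2 * (l div 2) + 1 = l"
    using assms(2) by simp
  then have "walks l u v = (if adj u v then (deg u * deg v) ^ (l div 2) else 0)" for u v
    using P4_closed_walks[OF P, where m = "l div 2" and u = u and v = v] by simp
  moreover have "deg u * deg v = s" if "adj u v" for u v
    using assms(1) that unfolding biclique_union_def by blast
  ultimately show ?thesis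
    using adj_irrefl unfolding swr_def by simp
qed

section \<open>The case \<open>\<mu> = 0\<close>\<close>

text \<open>The clique on d + 1 vertices has A = J - I, whence A^l = ((d^l - (-1)^l) / (d + 1)) J +
  (-1)^l I. The factor d + 1 keeps the identity within the integers.\<close>

lemma walks_clique:
  assumes "clique_union" and "u = v \<or> adj u v"
  shows "(int (deg v) + 1) * int (walks l u v) =
     int (deg v) ^ l + (if u = v then int (deg v) else - 1) * (- 1) ^ l"
  using assms(2)
proof (induction l arbitrary: u)
  case 0
  then show ?case by auto
next
  case (Suc l)
  note T = clique_unionD[OF assms(1)]
  let ?d = "int (deg v)"
  have eq: "(?d + 1) * int (walks (Suc l) u v) =
     (\<Sum>w\<in>nbs u. ?d ^ l + (if w = v then ?d else - 1) * (- 1) ^ l)"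
  proof -
    have "w = v \<or> adj w v" if "w \<in> nbs u" for w
      using that Suc.prems T[of w u v] adj_sym[of u w] by auto
    then show ?thesis
      by (simp add: sum_distrib_left Suc.IH)
  qed
  show ?case
  proof (cases "u = v")
    case True
    then have "(\<Sum>w\<in>nbs u. ?d ^ l + (if w = v then ?d else - 1) * (- 1) ^ l)
       = (\<Sum>w\<in>nbs v. ?d ^ l - (- 1) ^ l)"
      using adj_irrefl by (intro sum.cong) auto
    also have "\<dots> = ?d * (?d ^ l - (- 1) ^ l)"
      by (simp add: deg_def)
    finally show ?thesis
      unfolding eq using True by (simp add: algebra_simps)
  next
    case False
    then have a: "adj u v" using Suc.prems by simp
    have b: "adj v u" using a by (rule adj_sym)
    \<comment> \<open>Adjacent vertices of a clique union share their closed neighbourhood, so their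
      degrees agree.\<close>
    have "insert u (nbs u) = insert v (nbs v)"
    proof (rule Set.set_eqI)
      fix x
      show "x \<in> insert u (nbs u) \<longleftrightarrow> x \<in> insert v (nbs v)"
        using T[of v u x] T[of u v x] a b by auto
    qed
    then have "Suc (card (nbs u)) = Suc (card (nbs v))"
      using adj_irrefl[of u] adj_irrefl[of v] card_insert_disjoint[of "nbs u" u]
        card_insert_disjoint[of "nbs v" v] by simp
    then have du: "deg u = deg v"
      by (simp add: deg_def)
    have "(\<Sum>w\<in>nbs u. ?d ^ l + (if w = v then ?d else - 1) * (- 1) ^ l)
      = (\<Sum>w\<in>nbs u. (?d ^ l - (- 1) ^ l) + (if w = v then (?d + 1) * (- 1) ^ l else 0))"
      by (intro sum.cong) (auto simp: algebra_simps)
    also have "\<dots> = ?d * (?d ^ l - (- 1) ^ l) + (?d + 1) * (- 1) ^ l"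
      using a du by (simp only: sum.distrib) (simp add: deg_def)
    finally show ?thesis
      unfolding eq using False by (simp add: algebra_simps)
  qed
qed

end

text \<open>Makes the degree recoverable from \<open>lam\<close>: by \<open>walks_clique\<close>,
  \<open>lam\<close> is the quotient (d^l - (-1)^l) / (d + 1), compared here after
  cross-multiplication. At l = 1 the quotient would be constantly 1.\<close>

lemma clique_walks_ratio_strict:
  fixes d e :: nat
  assumes "0 < d" "d < e" "l > 1"
  shows "(int d ^ l - (- 1) ^ l) * (int e + 1) < (int e ^ l - (- 1) ^ l) * (int d + 1)"
proof -
  define m where "m = l - 2"
  have m: "l = Suc (Suc m)"
    using assms(3) unfolding m_def by simp
  define D E a b where "D = int d" and "E = int e" and "a = D ^ Suc m" and "b = E ^ Suc m"
  have DE: "0 < D" "D < E"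
    using assms unfolding D_def E_def by auto
  have "a < b"
    unfolding a_def b_def using DE by (intro power_strict_mono) auto
  have "1 \<le> a"
    unfolding a_def using DE by (intro one_le_power) auto
  have pos: "0 < D * (E * (b - a))" "0 \<le> D * (b - a)" "0 \<le> (E - D) * (b - 1)"
    using \<open>a < b\<close> \<open>1 \<le> a\<close> DE by auto
  define s where "s = (- 1 :: int) ^ l"
  have "s = 1 \<or> s = - 1"
    unfolding s_def by (cases "even l") auto
  then have "0 \<le> (E - D) * (1 + s)"
    using DE by auto
  \<comment> \<open>The difference of the two sides is a sum of nonnegative terms, the first of
    which is positive.\<close>
  moreover have "(E * b - s) * (D + 1) - (D * a - s) * (E + 1) =
      D * (E * (b - a)) + D * (b - a) + (E - D) * (b - 1) + (E - D) * (1 + s)"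
    by (simp add: algebra_simps)
  moreover have "int d ^ l = D * a" "int e ^ l = E * b"
    unfolding m a_def b_def D_def E_def by simp_all
  ultimately show ?thesis
    using pos unfolding D_def[symmetric] E_def[symmetric] s_def[symmetric]
    by (simp only:)
qed

context simple_graph
begin

text \<open>All degrees agree because \<open>lam\<close> determines them. Adjacent vertices then
  have k - 1 common neighbours, and non-adjacent ones, lying in different cliques, have none.
  Degrees are assumed positive since \<open>lam\<close> says nothing about isolated
  vertices.\<close>

lemma clique_swr_imp_srg:
  assumes c: "clique_union"
    and s: "swr l lam mu nu" "l > 1"
    and pos: "\<And>u. u \<in> V \<Longrightarrow> deg u > 0"
  shows "srg"
proof -
  note T = clique_unionD[OF c]
  have lam: "(int (deg v) + 1) * int lam = int (deg v) ^ l - (- 1) ^ l" if "v \<in> V" for v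
  proof -
    have "nbs v \<noteq> {}"
      using pos[OF that] unfolding deg_def by auto
    then obtain w where "adj v w"
      by (auto simp: nbs_def)
    then obtain u where u: "adj u v"
      using adj_sym by blast
    then have "walks l u v = lam" "u \<noteq> v"
      using s(1) \<open>v \<in> V\<close> adj_in_V[OF u] adj_irrefl[of v] unfolding swr_def by auto
    then show ?thesis
      using walks_clique[OF c, of u v l] u by auto
  qed
  have le: "\<not> deg u < deg v" if "u \<in> V" "v \<in> V" for u v
  proof
    assume "deg u < deg v"
    then have "(int (deg u) ^ l - (- 1) ^ l) * (int (deg v) + 1)
        < (int (deg v) ^ l - (- 1) ^ l) * (int (deg u) + 1)"
      by (intro clique_walks_ratio_strict pos that s)
    then show False
      unfolding lam[OF that(1), symmetric] lam[OF that(2), symmetric] by (simp add: algebra_simps)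
  qed
  have eq: "deg u = deg v" if "u \<in> V" "v \<in> V" for u v
    using le[OF that] le[OF that(2,1)] by simp
  obtain k where k: "\<forall>u\<in>V. deg u = k"
  proof (cases "V = {}")
    case False
    then obtain v where "v \<in> V" by blast
    then show ?thesis
      using that[of "deg v"] eq by blast
  qed (use that in simp)
  have "card (nbs u \<inter> nbs v) = (if adj u v then k - 1 else 0)"
    if "u \<in> V" "v \<in> V" "u \<noteq> v" for u v
  proof (cases "adj u v")
    case True
    have "nbs u \<inter> nbs v = nbs u - {v}"
    proof (rule Set.set_eqI)
      fix x
      show "x \<in> nbs u \<inter> nbs v \<longleftrightarrow> x \<in> nbs u - {v}"
        using T[of v u x] True adj_sym[of u v] adj_irrefl[of v] by auto
    qed
    then show ?thesis
      using True k that by (simp add: deg_def)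
  next
    case False
    then have "\<not> (adj u x \<and> adj v x)" for x
      using T[of u x v] adj_sym[of v x] \<open>u \<noteq> v\<close> by blast
    then have "nbs u \<inter> nbs v = {}"
      by auto
    then show ?thesis using False by simp
  qed
  then show ?thesis
    unfolding srg_def using k by blast
qed

lemma edgeless_imp_srg:
  assumes "\<And>u v. \<not> adj u v"
  shows "srg"
proof -
  have "nbs u = {}" for u
    using assms by auto
  then show ?thesis
    unfolding srg_def deg_def using assms
    by (intro exI[of _ "0::nat"] exI[of _ "0::nat"] exI[of _ "0::nat"]) simp
qed

text \<open>
  A shortest odd closed walk through \<open>v\<close> has length 3: its first two steps end in a vertex joined
  to \<open>v\<close> by a shorter odd walk, which is therefore equal or adjacent to \<open>v\<close>.
\<close>

lemma odd_closed_walk_imp_triangle: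
  assumes C: "\<And>j u w. walks j u w > 0 \<Longrightarrow> odd j \<Longrightarrow> j \<le> l \<Longrightarrow> u = w \<or> adj u w"
    and "walks l v v > 0" "odd l"
  obtains x y where "adj v x" "adj x y" "adj y v"
proof -
  define g where "g = (LEAST g. odd g \<and> walks g v v > 0)"
  have g: "odd g" "walks g v v > 0"
    using LeastI[of "\<lambda>g. odd g \<and> walks g v v > 0" l] assms unfolding g_def by auto
  have min: "g \<le> j" if "odd j" "walks j v v > 0" for j
    unfolding g_def using that by (intro Least_le) auto
  have "g \<noteq> 1"
    using g adj_irrefl by auto
  then obtain h where h: "g = Suc (Suc h)" "odd h"
    using that[of "g - 2"] g(1) by (cases "g = 0") auto
  obtain x y where xy: "adj v x" "adj x y" "walks h y v > 0"
    using g(2) unfolding h walks_Suc_pos by blast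
  have "h \<le> l"
    using min[of l] assms h by simp
  then have "y = v \<or> adj y v"
    using C xy h by blast
  moreover have "y \<noteq> v"
    using min[of h] xy h by auto
  ultimately show ?thesis
    using that xy by blast
qed

lemma swr_mu_0_imp:
  assumes s: "swr l lam 0 nu" "l > 1"
  shows "srg \<or> (\<exists>s. biclique_union s)"
proof -
  \<comment> \<open>Padding extends such a walk to length \<open>l\<close>, where
    \<open>mu = 0\<close> leaves only equal or adjacent ends.\<close>
  have C: "u = w \<or> adj u w"
    if "walks j u w > 0" "0 < j" "j \<le> l" "even (l - j)" for j u w
  proof -
    have "u \<in> V" "w \<in> V" if "u \<noteq> w"
    proof -
      obtain i where i: "j = Suc i" using \<open>0 < j\<close> gr0_implies_Suc by blast
      show "u \<in> V"
        using \<open>walks j u w > 0\<close> walks_Suc_pos adj_in_V unfolding i by blast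
      show "w \<in> V"
        using \<open>walks j u w > 0\<close> walks_Suc_pos adj_in_V
        unfolding i walks_sym[of _ u w] by blast
    qed
    then show ?thesis
      using walks_pos_pad'[OF that] s(1) unfolding swr_def by (metis less_irrefl)
  qed
  show ?thesis
  proof (cases "even l")
    case True
    have "adj u w" if "adj u v" "adj v w" "u \<noteq> w" for u v w
      using C[of 2 u w] walks_2_pos that s True by auto
    then have T: "clique_union"
      unfolding clique_union_def by blast
    show ?thesis
    proof (cases "\<exists>u v. adj u v")
      case False
      then show ?thesis using edgeless_imp_srg by blast
    next
      case e: True
      then obtain u v where uv: "adj u v" by blast
      \<comment> \<open>An edge traversed to and fro gives a closed walk, so \<open>nu\<close> is
        positive; hence every vertex lies on a closed walk and none is isolated.\<close>
      then have "walks l u u > 0"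
        using walks_pos_pad'[of 2 u u l] walks_2_pos[of u v u] adj_sym s True by auto
      then have "nu > 0"
        using s(1) uv adj_in_V unfolding swr_def by auto
      then have "deg x > 0" if "x \<in> V" for x
      proof -
        have "walks l x x > 0"
          using s(1) that \<open>nu > 0\<close> unfolding swr_def by auto
        then show ?thesis
          using walks_Suc_pos[of "l - 1" x x] deg_pos s(2) by auto
      qed
      then show ?thesis
        using clique_swr_imp_srg[OF T s] by blast
    qed
  next
    case False
    have C3: "u = w \<or> adj u w" if "walks 3 u w > 0" for u w
      using C[of 3 u w] that s False by (cases "l = 2") auto
    show ?thesis
    proof (cases "nu = 0")
      case True
      \<comment> \<open>A closed walk of length 3 would pad to one of length \<open>l\<close>,
        against \<open>nu = 0\<close>. With \<open>C3\<close>, the ends of a walk of length 3 are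
        therefore adjacent.\<close>
      have "u \<noteq> w" if "adj u x" "adj x v" "adj v w" for u x v w
      proof
        assume "u = w"
        then have "walks l u u > 0"
          using walks_pos_pad'[of 3 u u l] walks_3_pos[OF that] s False by (cases "l = 2") auto
        then show False
          using s(1) that adj_in_V True unfolding swr_def by auto
      qed
      then have P: "P4_closed"
        unfolding P4_closed_def using C3 walks_3_pos by blast
      have l: "l = 2 * (l div 2) + 1" "l div 2 > 0"
        using False s(2) by auto
      have "(deg u * deg v) ^ (l div 2) = lam" if uv: "adj u v" for u v
      proof -
        have "walks l u v = lam"
          using uv s(1) adj_in_V[OF uv] adj_in_V2[OF uv] adj_irrefl unfolding swr_def by auto
        then show ?thesis
          unfolding P4_closed_walks[OF P, of "l div 2" u v, folded l(1)] using uv by simp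
      qed
      then have "deg u * deg v = deg x * deg y" if "adj u v" "adj x y" for u v x y
        using l(2) that power_eq_imp_eq_base[of "deg u * deg v" "l div 2" "deg x * deg y"]
        by simp
      then have "\<exists>s. \<forall>u v. adj u v \<longrightarrow> deg u * deg v = s"
        by metis
      then show ?thesis
        using P unfolding biclique_union_def by metis
    next
      case n: False
      have tri: "\<exists>x y. adj v x \<and> adj x y \<and> adj y v" if "v \<in> V" for v
      proof -
        have "walks l v v > 0"
          using s(1) that n unfolding swr_def by auto
        moreover have "u = w \<or> adj u w" if "walks j u w > 0" "odd j" "j \<le> l" for j u w
          using C[of j u w] that False by (auto simp: odd_pos)
        ultimately show ?thesis
          using odd_closed_walk_imp_triangle[of l v] False by blast
      qed
      have "adj u w" if uv: "adj u v" and vw: "adj v w" and ne: "u \<noteq> w" for u v w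
      proof -
        obtain x y where xy: "adj v x" "adj x y" "adj y v"
          using tri adj_in_V2 uv by blast
        \<comment> \<open>The triangle through \<open>v\<close> supplies the parity: the walk u, v,
          y, x shows that \<open>u\<close> equals \<open>x\<close> or is adjacent to it. So
          \<open>u\<close> and \<open>v\<close> have a common neighbour \<open>z\<close>, namely
          \<open>y\<close> or \<open>x\<close> respectively, and u, z, v, w is a walk of length
          3.\<close>
        have ux: "u = x \<or> adj u x"
          using C3 walks_3_pos uv xy adj_sym by blast
        then obtain z where z: "adj u z" "adj z v"
          using xy adj_sym by blast
        then show ?thesis
          using C3 walks_3_pos vw ne by blast
      qed
      then have T: "clique_union"
        unfolding clique_union_def by blast
      have "deg x > 0" if "x \<in> V" for x
        using tri[OF that] deg_pos by blast
      then show ?thesis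
        using clique_swr_imp_srg[OF T s] by blast
    qed
  qed
qed

end

section \<open>The case \<open>\<mu> > 0\<close>\<close>

text \<open>Four distinct real roots would give three distinct critical points by Rolle's theorem.
  These satisfy l y^(l-1) = -a, hence share one absolute value, which only two reals can do.\<close>

lemma card_trinomial_roots_le:
  fixes a b :: real
  assumes "l > 1"
  shows "finite {x. x ^ l + a * x + b = 0}" "card {x. x ^ l + a * x + b = 0} \<le> 3"
proof -
  let ?R = "{x. x ^ l + a * x + b = 0}"
  let ?p = "monom 1 l + [:b, a:]"
  have "degree [:b, a:] < l"
    using assms by simp
  then have "coeff ?p l = 1"
    by (simp add: coeff_eq_0)
  then have "?p \<noteq> 0"
    by fastforce
  moreover have "?R = {x. poly ?p x = 0}"
    by (simp add: poly_monom algebra_simps)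
  ultimately show fin: "finite ?R"
    using poly_roots_finite[of ?p] by simp
  show "card ?R \<le> 3"
  proof (rule ccontr)
    assume "\<not> card ?R \<le> 3"
    define xs where "xs = sorted_list_of_set ?R"
    have len: "length xs > 3"
      using \<open>\<not> card ?R \<le> 3\<close> unfolding xs_def by simp
    have lt: "xs ! i < xs ! j" if "i < j" "j < length xs" for i j
      using that sorted_wrt_nth_less[OF strict_sorted_list_of_set[of ?R], of i j]
      unfolding xs_def by blast
    have root: "(xs ! i) ^ l + a * (xs ! i) + b = 0" if "i < length xs" for i
    proof -
      have "xs ! i \<in> ?R"
        using nth_mem[OF that] fin unfolding xs_def by simp
      then show ?thesis by simp
    qed
    have crit: "\<exists>y. xs ! i < y \<and> y < xs ! Suc i \<and> real l * y ^ (l - 1) + a = 0" if "i < 3" for i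
    proof -
      let ?f = "\<lambda>x. x ^ l + a * x + b"
      have "\<exists>y. xs ! i < y \<and> y < xs ! Suc i \<and>
          (\<lambda>v. (real l * y ^ (l - 1) + a) * v) = (\<lambda>v. 0)"
      proof (rule Rolle_deriv)
        show "xs ! i < xs ! Suc i"
          using lt len that by simp
        show "?f (xs ! i) = ?f (xs ! Suc i)"
          using root[of i] root[of "Suc i"] len that by simp
        show "continuous_on {xs ! i..xs ! Suc i} ?f"
          by (intro continuous_intros)
        show "(?f has_derivative (\<lambda>v. (real l * y ^ (l - 1) + a) * v)) (at y)" for y
          by (rule derivative_eq_intros refl | simp add: algebra_simps)+
      qed
      then obtain y where "xs ! i < y" "y < xs ! Suc i"
        and *: "(\<lambda>v. (real l * y ^ (l - 1) + a) * v) = (\<lambda>v. 0)"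
        by blast
      moreover have "real l * y ^ (l - 1) + a = 0"
        using fun_cong[OF *, of 1] by simp
      ultimately show ?thesis by blast
    qed
    obtain y0 where y0: "xs ! 0 < y0" "y0 < xs ! 1" "real l * y0 ^ (l - 1) + a = 0"
      using crit[of 0] by auto
    obtain y1 where y1: "xs ! 1 < y1" "y1 < xs ! 2" "real l * y1 ^ (l - 1) + a = 0"
      using crit[of 1] by (auto simp: numeral_2_eq_2)
    obtain y2 where y2: "xs ! 2 < y2" "real l * y2 ^ (l - 1) + a = 0"
      using crit[of 2] by auto
    have abs_eq: "\<bar>s\<bar> = \<bar>t\<bar>"
      if "real l * s ^ (l - 1) + a = 0" "real l * t ^ (l - 1) + a = 0" for s t
    proof -
      have "real l * s ^ (l - 1) = real l * t ^ (l - 1)"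
        using that by linarith
      then have "s ^ (l - 1) = t ^ (l - 1)"
        using assms unfolding mult_cancel_left by auto
      then have "\<bar>s ^ (l - 1)\<bar> = \<bar>t ^ (l - 1)\<bar>"
        by (rule arg_cong)
      then have "\<bar>s\<bar> ^ (l - 1) = \<bar>t\<bar> ^ (l - 1)"
        unfolding power_abs .
      then show ?thesis
        by (rule power_eq_imp_eq_base) (use assms in simp_all)
    qed
    show False
      using abs_eq[OF y0(3) y1(3)] abs_eq[OF y1(3) y2(2)] y0(1,2) y1(1,2) y2(1) by linarith
  qed
qed

text \<open>\<open>x\<close> and \<open>y\<close> may coincide, so sets with fewer than two elements
  need no separate treatment later.\<close>

lemma card_le_2_subset:
  assumes "finite A" "card A \<le> 2"
  obtains x y where "A \<subseteq> {x, y}"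
proof -
  consider "card A = 0" | "card A = 1" | "card A = 2"
    using assms(2) by linarith
  then show ?thesis
  proof cases
    case 1
    then show ?thesis using that assms by auto
  next
    case 2
    then obtain x where "A = {x}"
      by (rule card_1_singletonE)
    then show ?thesis using that[of x x] by simp
  next
    case 3
    then obtain x y where "A = {x, y}"
      unfolding card_2_iff by blast
    then show ?thesis using that[of x y] by simp
  qed
qed

section \<open>The adjacency operator and its polynomials\<close>

context simple_graph
begin

text \<open>The adjacency matrix A acting on functions, over any commutative ring so that the real
  and complex cases share their lemmas. Values outside \<open>V\<close> have no influence, see
  \<open>aop_cong\<close>.\<close>

definition aop :: "('a \<Rightarrow> 'b::comm_ring_1) \<Rightarrow> 'a \<Rightarrow> 'b" where
  "aop f u = (\<Sum>w\<in>nbs u. f w)"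

text \<open>This is p(A) f, evaluated by Horner's scheme.\<close>

definition peval :: "'b::comm_ring_1 poly \<Rightarrow> ('a \<Rightarrow> 'b) \<Rightarrow> 'a \<Rightarrow> 'b" where
  "peval p f = fold_coeffs (\<lambda>c g u. c * f u + aop g u) p (\<lambda>_. 0)"

definition eigenvalues :: "real set" where
  "eigenvalues = {x. \<exists>f. (\<exists>u\<in>V. f u \<noteq> 0) \<and> (\<forall>u\<in>V. aop f u = x * f u)}"

lemma aop_cong: "(\<And>u. u \<in> V \<Longrightarrow> f u = g u) \<Longrightarrow> aop f = aop g"
  unfolding aop_def using nbs_subset_V by (intro ext sum.cong) blast+

lemma aop_diff: "aop (\<lambda>u. f u - z * g u) = (\<lambda>u. aop f u - z * aop g u)"
  unfolding aop_def by (simp add: sum_subtractf sum_distrib_left)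

lemma aop_add: "aop (\<lambda>u. f u + g u) = (\<lambda>u. aop f u + aop g u)"
  unfolding aop_def by (simp add: sum.distrib)

lemma aop_mult: "aop (\<lambda>u. z * f u) = (\<lambda>u. z * aop f u)"
  unfolding aop_def by (simp add: sum_distrib_left)

lemma aop_zero: "aop (\<lambda>_. 0) = (\<lambda>_. 0)"
  unfolding aop_def by simp

lemma aop_one: "aop (\<lambda>_. 1) u = of_nat (deg u)"
  unfolding aop_def deg_def by simp

text \<open>Self-adjointness of A, inherited from the symmetry of adjacency.\<close>

lemma sum_aop_mult: "(\<Sum>u\<in>V. aop f u * g u) = (\<Sum>u\<in>V. f u * aop g u)"
proof -
  have "(\<Sum>u\<in>V. aop f u * g u) = (\<Sum>u\<in>V. \<Sum>w\<in>V. (if adj u w then f w * g u else 0))"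
    unfolding aop_def sum_nbs sum_distrib_right by (intro sum.cong) auto
  also have "\<dots> = (\<Sum>w\<in>V. \<Sum>u\<in>V. (if adj u w then f w * g u else 0))"
    by (rule sum.swap)
  also have "\<dots> = (\<Sum>u\<in>V. f u * aop g u)"
    unfolding aop_def sum_nbs sum_distrib_left by (intro sum.cong) (auto simp: adj_commute)
  finally show ?thesis .
qed

lemma aop_power:
  assumes "u \<in> V"
  shows "(aop ^^ l) f u = (\<Sum>v\<in>V. of_nat (walks l u v) * f v)"
  using assms
proof (induction l arbitrary: u)
  case 0
  have "(\<Sum>v\<in>V. of_nat (walks 0 u v) * f v) = (\<Sum>v\<in>V. if u = v then f v else 0)"
    by (intro sum.cong) auto
  then show ?case
    using 0 finite_V by simp
next
  case (Suc l)
  have "(aop ^^ Suc l) f u = (\<Sum>w\<in>nbs u. \<Sum>v\<in>V. of_nat (walks l w v) * f v)"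
    unfolding funpow.simps comp_def aop_def[of "(aop ^^ l) f"]
    using nbs_subset_V by (intro sum.cong refl Suc.IH) blast
  also have "\<dots> = (\<Sum>v\<in>V. \<Sum>w\<in>nbs u. of_nat (walks l w v) * f v)"
    by (rule sum.swap)
  finally show ?case
    by (simp add: sum_distrib_right)
qed

lemma peval_0 [simp]: "peval 0 f = (\<lambda>_. 0)"
  unfolding peval_def by simp

lemma peval_pCons [simp]: "peval (pCons c p) f = (\<lambda>u. c * f u + aop (peval p f) u)"
  unfolding peval_def by (cases "c = 0 \<and> p = 0") (auto simp: aop_zero)

lemma peval_add: "peval (p + q) f = (\<lambda>u. peval p f u + peval q f u)"
  by (induction p q rule: poly_induct2) (simp_all add: aop_add algebra_simps)

lemma peval_smult: "peval (Polynomial.smult c p) f = (\<lambda>u. c * peval p f u)"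
  by (induction p) (simp_all add: aop_mult algebra_simps)

lemma peval_monom: "peval (monom c n) f = (\<lambda>u. c * (aop ^^ n) f u)"
  by (induction n) (simp_all add: monom_0 monom_Suc aop_zero aop_mult)

lemma peval_aop: "peval p (aop f) = aop (peval p f)"
  by (induction p) (simp_all add: aop_zero aop_add aop_mult)

lemma peval_diff_right: "peval p (\<lambda>u. f u - z * g u) = (\<lambda>u. peval p f u - z * peval p g u)"
  by (induction p) (simp_all add: aop_diff algebra_simps)

text \<open>Moves a linear factor onto the argument, so that \<open>exists_eigenvector\<close> can
  strip off the roots of \<open>p\<close> one at a time.\<close>

lemma peval_linear_factor: "peval ([:- z, 1:] * p) f = peval p (\<lambda>u. aop f u - z * f u)"
proof -
  have "[:- z, 1:] * p = Polynomial.smult (- z) p + pCons 0 p"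
    by simp
  then show ?thesis
    by (simp only: peval_add peval_smult peval_pCons peval_diff_right peval_aop) simp
qed

lemma peval_eigenvector:
  assumes "\<And>u. u \<in> V \<Longrightarrow> aop g u = z * g u" "u \<in> V"
  shows "peval p g u = poly p z * g u"
  using assms(2)
proof (induction p arbitrary: u)
  case (pCons c p)
  have "aop (peval p g) = aop (\<lambda>u. poly p z * g u)"
    using pCons.IH by (intro aop_cong) auto
  then have "aop (peval p g) u = poly p z * (z * g u)"
    using assms(1) pCons.prems by (simp only: aop_mult)
  then show ?case
    by (simp add: algebra_simps)
qed simp

lemma sum_peval_mult: "(\<Sum>u\<in>V. peval p f u * g u) = (\<Sum>u\<in>V. f u * peval p g u)"
proof (induction p arbitrary: g)
  case (pCons c p)
  have "(\<Sum>u\<in>V. aop (peval p f) u * g u) = (\<Sum>u\<in>V. f u * aop (peval p g) u)"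
    by (simp only: sum_aop_mult pCons.IH peval_aop)
  then show ?case
    by (simp add: sum.distrib algebra_simps)
qed simp

text \<open>Follow the partial products of the linear factors of \<open>p\<close> applied to \<open>f\<close> until they vanish.\<close>

lemma exists_eigenvector:
  fixes p :: "complex poly"
  assumes "p \<noteq> 0" "\<And>u. u \<in> V \<Longrightarrow> peval p f u = 0" "\<exists>u\<in>V. f u \<noteq> 0" "Q f"
    and closed: "\<And>g z. Q g \<Longrightarrow> Q (\<lambda>u. aop g u - z * g u)"
  shows "\<exists>z g. Q g \<and> (\<exists>u\<in>V. g u \<noteq> 0) \<and> (\<forall>u\<in>V. aop g u = z * g u)"
  using assms(1-4)
proof (induction "degree p" arbitrary: p f)
  case 0
  then obtain c where "p = [:c:]" "c \<noteq> 0"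
    using degree_eq_zeroE[of p] by auto
  then have False
    using 0(3,4) by (auto simp: aop_zero)
  then show ?case ..
next
  case (Suc n)
  obtain z where "poly p z = 0"
    using Suc.hyps(2) fundamental_theorem_of_algebra[of p] by (auto simp: constant_degree)
  then obtain q where q: "p = [:- z, 1:] * q"
    unfolding poly_eq_0_iff_dvd by (elim dvdE)
  have "q \<noteq> 0"
    using Suc.prems(1) q by auto
  have n: "n = degree q"
    using Suc.hyps(2) \<open>q \<noteq> 0\<close> unfolding q by (subst (asm) degree_mult_eq) auto
  let ?h = "\<lambda>u. aop f u - z * f u"
  show ?case
  proof (cases "\<exists>u\<in>V. ?h u \<noteq> 0")
    case True
    have "peval q ?h u = 0" if "u \<in> V" for u
      using Suc.prems(2)[OF that] unfolding q peval_linear_factor .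
    then show ?thesis
      by (rule Suc.hyps(1)[OF n \<open>q \<noteq> 0\<close> _ True closed[OF Suc.prems(4)]])
  next
    case False
    then have "\<forall>u\<in>V. aop f u = z * f u"
      by simp
    then show ?thesis
      using Suc.prems(3,4) by (intro exI[of _ z] exI[of _ f] conjI)
  qed
qed

section \<open>From complex eigenvectors to real eigenvalues\<close>

lemma sum_mult_cnj_nonzero:
  assumes "\<exists>u\<in>V. g u \<noteq> 0"
  shows "(\<Sum>u\<in>V. g u * cnj (g u)) \<noteq> 0"
proof -
  have "(\<Sum>u\<in>V. g u * cnj (g u)) = of_real (\<Sum>u\<in>V. (cmod (g u))\<^sup>2)"
    by (simp add: complex_norm_square[symmetric])
  moreover have "(\<Sum>u\<in>V. (cmod (g u))\<^sup>2) \<noteq> 0"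
    using assms finite_V by (subst sum_nonneg_eq_0_iff) auto
  ultimately show ?thesis
    by (simp only: of_real_eq_0_iff not_False_eq_True)
qed

text \<open>The usual Hermitian argument: the inner product of A g with g, computed in two ways, is
  both z and \<open>cnj z\<close> times the nonzero squared norm \<open>?n\<close>.\<close>

lemma complex_eigenvalue_real:
  fixes g :: "'a \<Rightarrow> complex"
  assumes "\<exists>u\<in>V. g u \<noteq> 0" and eig: "\<And>u. u \<in> V \<Longrightarrow> aop g u = z * g u"
  shows "z \<in> \<real>"
proof -
  let ?g = "\<lambda>u. cnj (g u)"
  let ?n = "\<Sum>u\<in>V. g u * ?g u"
  have eig': "aop ?g u = cnj z * ?g u" if "u \<in> V" for u
    using arg_cong[OF eig[OF that], of cnj] unfolding aop_def by simp
  have "z * ?n = (\<Sum>u\<in>V. aop g u * ?g u)"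
    using eig by (simp add: sum_distrib_left mult.assoc)
  also have "\<dots> = (\<Sum>u\<in>V. g u * aop ?g u)"
    by (rule sum_aop_mult)
  also have "\<dots> = cnj z * ?n"
    using eig' by (simp add: sum_distrib_left algebra_simps)
  finally have "z * ?n = cnj z * ?n" .
  moreover have "?n \<noteq> 0"
    using assms(1) by (rule sum_mult_cnj_nonzero)
  ultimately show ?thesis
    by (simp add: Reals_cnj_iff)
qed

text \<open>As z and A are real, the real and imaginary parts of \<open>g\<close> both satisfy the
  eigenvector equation, and one of them is nonzero on \<open>V\<close>.\<close>

lemma complex_eigenvalue:
  fixes g :: "'a \<Rightarrow> complex"
  assumes nz: "\<exists>u\<in>V. g u \<noteq> 0" and eig: "\<And>u. u \<in> V \<Longrightarrow> aop g u = z * g u"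
  obtains x where "z = of_real x" "x \<in> eigenvalues"
proof -
  obtain x where x: "z = of_real x"
    using complex_eigenvalue_real[OF assms] Reals_cases by blast
  have "aop (\<lambda>u. Re (g u)) u = x * Re (g u)" if "u \<in> V" for u
    using arg_cong[OF eig[OF that], of Re] unfolding aop_def x by simp
  then have "x \<in> eigenvalues" if "\<exists>u\<in>V. Re (g u) \<noteq> 0"
    unfolding eigenvalues_def using that by (intro CollectI exI[of _ "\<lambda>u. Re (g u)"]) simp
  moreover have "aop (\<lambda>u. Im (g u)) u = x * Im (g u)" if "u \<in> V" for u
    using arg_cong[OF eig[OF that], of Im] unfolding aop_def x by simp
  then have "x \<in> eigenvalues" if "\<exists>u\<in>V. Im (g u) \<noteq> 0"
    unfolding eigenvalues_def using that by (intro CollectI exI[of _ "\<lambda>u. Im (g u)"]) simp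
  moreover have "(\<exists>u\<in>V. Re (g u) \<noteq> 0) \<or> (\<exists>u\<in>V. Im (g u) \<noteq> 0)"
    using nz by (auto simp: complex_eq_iff)
  ultimately have "x \<in> eigenvalues"
    by blast
  then show ?thesis using that x by blast
qed

text \<open>Write the hypothesis as p(A) = mu J. Then A p(A) is symmetric, being a polynomial in A,
  whereas entry (u, v) of mu A J is \<open>deg u * mu\<close>.\<close>

lemma swr_pos_imp_regular:
  assumes s: "swr l lam mu nu" and mu: "mu > 0" and V: "u \<in> V" "v \<in> V"
  shows "deg u = deg v"
proof -
  let ?a = "int mu - int lam" and ?b = "int mu - int nu"
  have eq: "int mu = int (walks l x y) + ?a * of_bool (adj x y) + ?b * of_bool (x = y)"
    if "x \<in> V" "y \<in> V" for x y
    using s that adj_irrefl unfolding swr_def by auto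
  \<comment> \<open>\<open>c x y\<close> is entry (x, y) of A p(A); common neighbours are the
    entries of A^2.\<close>
  define c where "c = (\<lambda>x y. int (walks (Suc l) x y) + ?a * int (card (nbs x \<inter> nbs y))
      + ?b * of_bool (adj x y))"
  have deg: "int (deg x) * int mu = c x y" if "x \<in> V" "y \<in> V" for x y
  proof -
    have "int (deg x) * int mu = (\<Sum>w\<in>nbs x. int mu)"
      by (simp add: deg_def)
    also have "\<dots> = (\<Sum>w\<in>nbs x. int (walks l w y) + ?a * of_bool (adj w y) + ?b * of_bool (w = y))"
      using eq that adj_in_V2 by (intro sum.cong) auto
    also have "\<dots> = int (walks (Suc l) x y) + ?a * (\<Sum>w\<in>nbs x. of_bool (adj w y))
        + ?b * (\<Sum>w\<in>nbs x. of_bool (w = y))"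
      by (simp only: sum.distrib sum_distrib_left walks.simps of_nat_sum)
    also have "(\<Sum>w\<in>nbs x. of_bool (adj w y)) = int (card (nbs x \<inter> nbs y))"
    proof -
      have "nbs x \<inter> {w. adj w y} = nbs x \<inter> nbs y"
        by (auto simp: adj_commute)
      then show ?thesis
        by (simp add: of_bool_def sum.If_cases)
    qed
    also have "(\<Sum>w\<in>nbs x. of_bool (w = y)) = (of_bool (adj x y) :: int)"
      by (simp add: of_bool_def)
    finally show ?thesis
      unfolding c_def .
  qed
  have "c u v = c v u"
    unfolding c_def by (simp only: walks_sym[of "Suc l" u v] Int_commute[of "nbs u"] adj_commute[of u v])
  then have "int (deg u) * int mu = int (deg v) * int mu"
    using deg[OF V] deg[OF V(2,1)] by simp
  then show ?thesis
    using mu by simp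
qed

text \<open>Chosen so that its value at A is mu J.\<close>

definition swr_poly :: "nat \<Rightarrow> nat \<Rightarrow> nat \<Rightarrow> nat \<Rightarrow> 'b::comm_ring_1 poly" where
  "swr_poly l lam mu nu = monom 1 l + [:of_nat mu - of_nat nu, of_nat mu - of_nat lam:]"

lemma poly_swr_poly:
  "poly (swr_poly l lam mu nu) x = x ^ l + (of_nat mu - of_nat lam) * x + (of_nat mu - of_nat nu)"
  unfolding swr_poly_def by (simp add: poly_monom algebra_simps)

text \<open>Solving \<open>swr\<close> for the walk counts expresses A^l through J, A and I; the
  last two cancel against the linear part of the polynomial.\<close>

lemma peval_swr_poly:
  assumes "swr l lam mu nu" "u \<in> V"
  shows "peval (swr_poly l lam mu nu) f u = of_nat mu * (\<Sum>v\<in>V. f v)"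
proof -
  have w: "of_nat (walks l u v) = of_nat mu - (of_nat mu - of_nat lam) * of_bool (adj u v)
      - (of_nat mu - of_nat nu) * (of_bool (u = v) :: 'b)" if "v \<in> V" for v
    using assms that adj_irrefl unfolding swr_def by auto
  have a: "aop f u = (\<Sum>v\<in>V. of_bool (adj u v) * f v)"
    unfolding aop_def sum_nbs by (intro sum.cong) auto
  have b: "f u = (\<Sum>v\<in>V. of_bool (u = v) * f v)"
  proof -
    have "(\<Sum>v\<in>V. of_bool (u = v) * f v) = (\<Sum>v\<in>V. if u = v then f v else 0)"
      by (intro sum.cong) auto
    then show ?thesis using assms(2) finite_V by simp
  qed
  have "peval (swr_poly l lam mu nu) f u =
      (aop ^^ l) f u + ((of_nat mu - of_nat nu) * f u + (of_nat mu - of_nat lam) * aop f u)"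
    unfolding swr_poly_def peval_add peval_monom by (simp add: aop_zero aop_mult)
  also have "(aop ^^ l) f u = (\<Sum>v\<in>V. of_nat mu * f v
      - (of_nat mu - of_nat lam) * (of_bool (adj u v) * f v)
      - (of_nat mu - of_nat nu) * (of_bool (u = v) * f v))"
    unfolding aop_power[OF assms(2)] by (intro sum.cong refl) (simp only: w left_diff_distrib mult.assoc)
  also have "\<dots> = of_nat mu * (\<Sum>v\<in>V. f v) - (of_nat mu - of_nat lam) * aop f u
      - (of_nat mu - of_nat nu) * f u"
    by (simp only: sum_subtractf sum_distrib_left[symmetric] a b[symmetric])
  finally show ?thesis
    by simp
qed

section \<open>The spectrum in the regular case\<close>

lemma sum_aop_regular:
  assumes "\<And>u. u \<in> V \<Longrightarrow> deg u = k"
  shows "(\<Sum>u\<in>V. aop f u) = of_nat k * (\<Sum>u\<in>V. f u)"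
proof -
  have "(\<Sum>u\<in>V. aop f u * 1) = (\<Sum>u\<in>V. f u * aop (\<lambda>_. 1) u)"
    by (rule sum_aop_mult)
  then show ?thesis
    using assms by (simp add: aop_one sum_distrib_left mult.commute)
qed

lemma degree_in_eigenvalues:
  assumes "\<And>u. u \<in> V \<Longrightarrow> deg u = k" "V \<noteq> {}"
  shows "real k \<in> eigenvalues"
  unfolding eigenvalues_def using assms
  by (intro CollectI exI[of _ "\<lambda>_. 1"]) (auto simp: aop_one)

text \<open>Summing A f = x f over \<open>V\<close> gives (k - x) times the sum of \<open>f\<close>
  equal to 0. So x = k, or \<open>f\<close> has sum 0 and is annihilated by mu J = p(A), which makes
  x a root of p.\<close>

lemma eigenvalues_subset:
  assumes s: "swr l lam mu nu" and k: "\<And>u. u \<in> V \<Longrightarrow> deg u = k"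
  shows "eigenvalues \<subseteq> insert (real k) {x. poly (swr_poly l lam mu nu) x = 0}"
proof
  fix x assume "x \<in> eigenvalues"
  then obtain f u where f: "u \<in> V" "f u \<noteq> 0" "\<And>u. u \<in> V \<Longrightarrow> aop f u = x * f u"
    unfolding eigenvalues_def by blast
  have "real k * (\<Sum>u\<in>V. f u) = x * (\<Sum>u\<in>V. f u)"
    using sum_aop_regular[OF k, of f] f(3) by (simp add: sum_distrib_left)
  moreover have "poly (swr_poly l lam mu nu) x = 0" if "(\<Sum>u\<in>V. f u) = 0"
    using peval_swr_poly[OF s f(1), of f] peval_eigenvector[OF f(3,1)] f(2) that by simp
  ultimately show "x \<in> insert (real k) {x. poly (swr_poly l lam mu nu) x = 0}"
    by auto
qed

lemma card_eigenvalues_le: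
  assumes "swr l lam mu nu" "l > 1" "\<And>u. u \<in> V \<Longrightarrow> deg u = k"
  shows "finite eigenvalues" "card eigenvalues \<le> 4"
proof -
  let ?R = "{x. poly (swr_poly l lam mu nu) x = (0::real)}"
  have R: "finite ?R" "card ?R \<le> 3"
    unfolding poly_swr_poly using card_trinomial_roots_le[OF assms(2)] by blast+
  have sub: "eigenvalues \<subseteq> insert (real k) ?R"
    using eigenvalues_subset[OF assms(1,3)] by blast
  show "finite eigenvalues"
    using finite_subset[OF sub] R by simp
  have "card eigenvalues \<le> card (insert (real k) ?R)"
    using sub R by (intro card_mono) auto
  also have "\<dots> \<le> Suc (card ?R)"
    by (rule card_insert_le_m1) (use R in auto)
  finally show "card eigenvalues \<le> 4"
    using R by simp
qed

end

text \<open>If nothing satisfies \<open>P\<close>, any value serves; this covers graphs lacking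
  adjacent or non-adjacent pairs.\<close>

lemma constant_value:
  assumes "\<And>x y. P x \<Longrightarrow> P y \<Longrightarrow> f x = f y"
  obtains a where "\<And>x. P x \<Longrightarrow> f x = a"
proof (cases "\<exists>x. P x")
  case True
  then obtain y where "P y" by blast
  then show ?thesis
    using that[of "f y"] assms by blast
qed (use that in blast)

context simple_graph
begin

text \<open>If M(A) w were nonzero, the A-invariant space of all M(A) h with sum 0 would contain an
  eigenvector \<open>g\<close>. Its eigenvalue is a root of p, hence not k, hence x or y, and so a
  root of M. But then \<open>g\<close>, being M(A) h, has norm zero by self-adjointness.\<close>

lemma quadratic_annihilates:
  fixes w :: "'a \<Rightarrow> complex"
  assumes s: "swr l lam mu nu" and l: "l > 1" and mu: "mu > 0" and ne: "V \<noteq> {}"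
    and k: "\<And>u. u \<in> V \<Longrightarrow> deg u = k"
    and sub: "eigenvalues - {real k} \<subseteq> {x, y}"
    and w: "(\<Sum>u\<in>V. w u) = 0" and "u \<in> V"
  shows "peval [:of_real (x * y), - of_real (x + y), 1:] w u = 0"
proof (rule ccontr)
  let ?M = "[:of_real (x * y), - of_real (x + y), 1:] :: complex poly"
  let ?P = "swr_poly l lam mu nu :: complex poly"
  assume nz: "peval ?M w u \<noteq> 0"
  \<comment> \<open>Sum 0 makes p(A) vanish on \<open>g\<close>; membership in the image of M(A)
    makes the norm of \<open>g\<close> vanish at the end.\<close>
  define Q where "Q g \<longleftrightarrow> (\<Sum>u\<in>V. g u) = 0 \<and> (\<exists>h. g = peval ?M h)" for g
  have sum_peval: "(\<Sum>u\<in>V. peval p h u) = 0" if "(\<Sum>u\<in>V. h u) = 0" for p and h :: "'a \<Rightarrow> complex"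
    by (induction p) (simp_all add: sum.distrib sum_aop_regular[OF k] sum_distrib_left[symmetric] that)
  have QM: "Q (peval ?M w)"
    unfolding Q_def using sum_peval[OF w] by blast
  have closed: "Q (\<lambda>u. aop g u - z * g u)" if Qg: "Q g" for g z
  proof -
    obtain h where h: "g = peval ?M h" "(\<Sum>u\<in>V. g u) = 0"
      using Qg unfolding Q_def by blast
    have "(\<lambda>u. aop g u - z * g u) = peval ?M (\<lambda>u. aop h u - z * h u)"
      unfolding h(1) peval_diff_right peval_aop ..
    moreover have "(\<Sum>u\<in>V. aop g u - z * g u) = 0"
      by (simp add: sum_subtractf sum_aop_regular[OF k] sum_distrib_left[symmetric] h(2))
    ultimately show ?thesis
      unfolding Q_def by blast
  qed
  have P_zero: "peval ?P g u = 0" if "Q g" "u \<in> V" for g u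
    using peval_swr_poly[OF s that(2), of g] that(1) unfolding Q_def by simp
  \<comment> \<open>Applying p(A) = mu J to the all-ones function shows that k is not a root of
    p.\<close>
  have Pk: "poly ?P (of_nat k) = of_nat mu * of_nat (card V)"
  proof -
    have "peval ?P (\<lambda>_. 1) u = poly ?P (of_nat k) * 1"
      using \<open>u \<in> V\<close> k by (intro peval_eigenvector) (simp_all add: aop_one)
    then show ?thesis
      using peval_swr_poly[OF s \<open>u \<in> V\<close>, of "\<lambda>_. 1 :: complex"] by simp
  qed
  then have Pk_nz: "poly ?P (of_nat k) \<noteq> 0"
    using mu ne finite_V by simp
  then have "?P \<noteq> 0"
    by (metis poly_0)
  then obtain z g where g: "Q g" "\<exists>u\<in>V. g u \<noteq> 0" and eig: "\<And>u. u \<in> V \<Longrightarrow> aop g u = z * g u"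
    using exists_eigenvector[where p = ?P and f = "peval ?M w" and Q = Q, OF _ P_zero[OF QM] _ QM closed]
      nz \<open>u \<in> V\<close> by blast
  obtain r where r: "z = of_real r" "r \<in> eigenvalues"
    using complex_eigenvalue[OF g(2) eig] by blast
  obtain v where v: "v \<in> V" "g v \<noteq> 0"
    using g(2) by blast
  have "poly ?P z = 0"
    using P_zero[OF g(1) v(1)] peval_eigenvector[OF eig v(1), of ?P] v(2) by simp
  then have "z \<noteq> of_nat k"
    using Pk_nz by auto
  then have "r = x \<or> r = y"
    using r sub by auto
  then have Mz: "poly ?M z = 0"
    unfolding r(1) by (auto simp: algebra_simps)
  obtain h where h: "g = peval ?M h"
    using g(1) unfolding Q_def by blast
  \<comment> \<open>M(A) is moved from \<open>h\<close> to the conjugate of \<open>g\<close>, where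
    it acts as multiplication by M(z) = 0.\<close>
  have "(\<Sum>u\<in>V. g u * cnj (g u)) = (\<Sum>u\<in>V. h u * peval ?M (\<lambda>u. cnj (g u)) u)"
    unfolding sum_peval_mult[symmetric] h[symmetric] ..
  also have "peval ?M (\<lambda>u. cnj (g u)) u = 0" if "u \<in> V" for u
  proof -
    have "aop (\<lambda>u. cnj (g u)) u = z * cnj (g u)" if "u \<in> V" for u
      using arg_cong[OF eig[OF that], of cnj] unfolding aop_def r(1) by simp
    then show ?thesis
      using peval_eigenvector[of "\<lambda>u. cnj (g u)" z u ?M] that Mz by simp
  qed
  then have "(\<Sum>u\<in>V. h u * peval ?M (\<lambda>u. cnj (g u)) u) = 0"
    by simp
  finally have "(\<Sum>u\<in>V. g u * cnj (g u)) = 0" .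
  then show False
    using sum_mult_cnj_nonzero[OF g(2)] by simp
qed

section \<open>Strong regularity from at most three eigenvalues\<close>

lemma aop_of_bool: "aop (\<lambda>w. of_bool (w = v)) = (\<lambda>u. of_bool (adj u v))"
  unfolding aop_def by (simp add: of_bool_def)

lemma aop_of_bool_adj: "aop (\<lambda>w. of_bool (adj w v)) = (\<lambda>u. of_nat (card (nbs u \<inter> nbs v)))"
proof -
  have "nbs u \<inter> {w. adj w v} = nbs u \<inter> nbs v" for u
    by (auto simp: adj_commute)
  then show ?thesis
    unfolding aop_def by (simp add: of_bool_def sum.If_cases)
qed

text \<open>M(A) = A^2 - (x + y) A + x y I kills every function of sum 0, so it is a multiple of J.
  Off the diagonal this determines the number of common neighbours from adjacency alone.\<close>

lemma few_eigenvalues_imp_srg: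
  assumes s: "swr l lam mu nu" and l: "l > 1" and mu: "mu > 0" and ne: "V \<noteq> {}"
    and k: "\<And>u. u \<in> V \<Longrightarrow> deg u = k"
    and card: "card eigenvalues \<le> 3"
  shows "srg"
proof -
  have fin: "finite eigenvalues"
    using card_eigenvalues_le[OF s l k] by blast
  have "card (eigenvalues - {real k}) \<le> 2"
    using card degree_in_eigenvalues[OF k ne] fin by simp
  then obtain x y where sub: "eigenvalues - {real k} \<subseteq> {x, y}"
    using fin by (elim card_le_2_subset[rotated]) auto
  let ?M = "[:of_real (x * y), - of_real (x + y), 1:] :: complex poly"
  define K where "K u v = of_real (x * y) * of_bool (u = v) - of_real (x + y) * of_bool (adj u v)
      + (of_nat (card (nbs u \<inter> nbs v)) :: complex)" for u v
  have peval_M: "peval ?M (\<lambda>w. of_bool (w = v)) u = K u v" for u v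
    unfolding K_def
    by (simp only: peval_pCons peval_0 aop_zero aop_add aop_mult aop_of_bool aop_of_bool_adj) simp
  \<comment> \<open>\<open>K\<close> holds the entries of M(A). The difference of two indicator
    functions has sum 0, so the columns of \<open>K\<close> agree, and symmetry makes
    \<open>K\<close> constant. The factor 1 fits \<open>peval_diff_right\<close>.\<close>
  have col: "K u v = K u v'" if "u \<in> V" "v \<in> V" "v' \<in> V" for u v v'
  proof -
    have "(\<Sum>w\<in>V. of_bool (w = v) - 1 * of_bool (w = v')) = (0 :: complex)"
      using that finite_V by (simp add: sum_subtractf of_bool_def)
    then have "peval ?M (\<lambda>w. of_bool (w = v) - 1 * of_bool (w = v')) u = 0"
      using quadratic_annihilates[OF s l mu ne k sub _ that(1)] by blast
    then show ?thesis
      unfolding peval_diff_right peval_M by simp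
  qed
  have sym: "K u v = K v u" for u v
    unfolding K_def by (simp add: Int_commute adj_commute eq_commute)
  have K: "K u v = K u' v'" if "u \<in> V" "v \<in> V" "u' \<in> V" "v' \<in> V" for u v u' v'
    using col[of u v u'] col[of u' v' u] sym[of u u'] that by simp
  have cn: "card (nbs u \<inter> nbs v) = card (nbs u' \<inter> nbs v')"
    if "u \<in> V" "v \<in> V" "u' \<in> V" "v' \<in> V" "u \<noteq> v" "u' \<noteq> v'" "adj u v = adj u' v'" for u v u' v'
  proof -
    have "(of_nat (card (nbs u \<inter> nbs v)) :: complex) = of_nat (card (nbs u' \<inter> nbs v'))"
      using K[OF that(1-4)] that(5-) unfolding K_def by simp
    then show ?thesis
      by (simp only: of_nat_eq_iff)
  qed
  \<comment> \<open>The Boolean index treats adjacent and non-adjacent pairs at once; either set may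
    be empty.\<close>
  define pairs where "pairs b = {(u, v). u \<in> V \<and> v \<in> V \<and> u \<noteq> v \<and> adj u v = b}" for b
  have "\<exists>a. \<forall>p\<in>pairs b. card (nbs (fst p) \<inter> nbs (snd p)) = a" for b
    by (rule constant_value[of "\<lambda>p. p \<in> pairs b" "\<lambda>p. card (nbs (fst p) \<inter> nbs (snd p))"])
      (auto simp: pairs_def intro!: cn)
  then obtain a where a: "\<forall>b. \<forall>p\<in>pairs b. card (nbs (fst p) \<inter> nbs (snd p)) = a b"
    by metis
  have "card (nbs u \<inter> nbs v) = (if adj u v then a True else a False)"
    if "u \<in> V" "v \<in> V" "u \<noteq> v" for u v
    using a[rule_format, of "(u, v)" "adj u v"] that unfolding pairs_def by simp
  then show ?thesis
    unfolding srg_def using k by blast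
qed

lemma swr_classification:
  assumes s: "swr l lam mu nu" "l > 1" and ne: "V \<noteq> {}"
  shows "srg \<or> (\<exists>s. biclique_union s) \<or> ((\<exists>k. \<forall>u\<in>V. deg u = k) \<and> card eigenvalues = 4)"
proof (cases "mu = 0")
  case True
  then show ?thesis
    using swr_mu_0_imp s by blast
next
  case False
  then have mu: "mu > 0"
    by simp
  obtain k where k: "\<And>u. u \<in> V \<Longrightarrow> deg u = k"
    using constant_value[of "\<lambda>u. u \<in> V" deg] swr_pos_imp_regular[OF s(1) mu] by metis
  show ?thesis
  proof (cases "card eigenvalues = 4")
    case True
    then show ?thesis
      using k by blast
  next
    case False
    then have "card eigenvalues \<le> 3"
      using card_eigenvalues_le[OF s k] by simp
    then show ?thesis
      using few_eigenvalues_imp_srg[OF s mu ne k] by blast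
  qed
qed

end

section \<open>Digraphs\<close>

sublocale graph \<subseteq> sg: simple_graph "verts G" "\<lambda>u v. (u, v) \<in> arcs_ends G"
proof
  show "(u, v) \<in> arcs_ends G \<Longrightarrow> u \<in> verts G" for u v
    using adj_in_verts by blast
  show "(u, v) \<in> arcs_ends G \<Longrightarrow> (v, u) \<in> arcs_ends G" for u v
    using graph_symmetric by blast
  show "(u, u) \<notin> arcs_ends G" for u
    using adj_not_same by blast
qed simp

context graph
begin

text \<open>Injectivity is the absence of parallel arcs. Degrees and walks, defined through arcs,
  can thereby be counted through neighbours.\<close>

lemma bij_betw_out_arcs: "bij_betw (head G) (out_arcs G u) (sg.nbs u)"
proof (rule bij_betwI')
  fix e f assume "e \<in> out_arcs G u" "f \<in> out_arcs G u"
  then show "(head G e = head G f) = (e = f)"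
    using no_multi_arcs[of e f] by (auto simp: arc_to_ends_def)
next
  fix e assume "e \<in> out_arcs G u"
  then show "head G e \<in> sg.nbs u"
    using dominatesI[of e u "head G e"] by (auto simp: arc_to_ends_def)
next
  fix v assume "v \<in> sg.nbs u"
  then have "(u, v) \<in> arcs_ends G"
    by simp
  then show "\<exists>e\<in>out_arcs G u. v = head G e"
    by (auto simp: arcs_ends_conv)
qed

lemma out_degree_eq_deg: "out_degree G u = sg.deg u"
  unfolding out_degree_def sg.deg_def using bij_betw_same_card[OF bij_betw_out_arcs] .

lemma finite_awalks_length: "finite {p. awalk u p v \<and> length p = l}"
proof (rule finite_subset)
  show "{p. awalk u p v \<and> length p = l} \<subseteq> {p. set p \<subseteq> arcs G \<and> length p = l}"
    by (auto simp: awalk_def)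
  show "finite {p. set p \<subseteq> arcs G \<and> length p = l}"
    using finite_lists_length_eq[OF finite_arcs] .
qed

text \<open>Walks are split by their first arc. At length 0 the empty arc list is a walk only if
  \<open>u\<close> is a vertex of \<open>G\<close>.\<close>

lemma num_walks_eq_walks: "u \<in> verts G \<Longrightarrow> num_walks G l u v = sg.walks l u v"
proof (induction l arbitrary: u)
  case 0
  then have "{p. awalk u p v \<and> length p = 0} = (if u = v then {[]} else {})"
    by (auto simp: awalk_Nil_iff)
  then show ?case
    unfolding num_walks_def by simp
next
  case (Suc l)
  let ?W = "\<lambda>u l. {p. awalk u p v \<and> length p = l}"
  have "?W u (Suc l) = (\<Union>e\<in>out_arcs G u. (#) e ` ?W (head G e) l)"
    by (auto simp: length_Suc_conv awalk_Cons_iff)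
  then have "num_walks G (Suc l) u v = card (\<Union>e\<in>out_arcs G u. (#) e ` ?W (head G e) l)"
    unfolding num_walks_def by simp
  also have "\<dots> = (\<Sum>e\<in>out_arcs G u. card ((#) e ` ?W (head G e) l))"
    by (rule card_UN_disjoint) (use finite_awalks_length in auto)
  also have "\<dots> = (\<Sum>e\<in>out_arcs G u. num_walks G l (head G e) v)"
    unfolding num_walks_def by (intro sum.cong refl card_image) auto
  also have "\<dots> = (\<Sum>w\<in>sg.nbs u. num_walks G l w v)"
    by (rule sum.reindex_bij_betw[OF bij_betw_out_arcs])
  also have "\<dots> = (\<Sum>w\<in>sg.nbs u. sg.walks l w v)"
    using sg.nbs_subset_V by (intro sum.cong refl Suc.IH) blast
  finally show ?case
    by simp
qed

lemma strongly_walk_regular_iff: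
  "strongly_walk_regular l G \<longleftrightarrow> l > 1 \<and> (\<exists>lam mu nu. sg.swr l lam mu nu)"
proof -
  have "strongly_walk_regular_with l lam mu nu G \<longleftrightarrow> l > 1 \<and> sg.swr l lam mu nu" for lam mu nu
    unfolding strongly_walk_regular_with_def sg.swr_def
    using adj_not_same by (intro conj_cong ball_cong refl) (auto simp: num_walks_eq_walks)
  then show ?thesis
    unfolding strongly_walk_regular_def by blast
qed

lemma regular_graph_iff: "regular_graph G \<longleftrightarrow> (\<exists>k. \<forall>u\<in>verts G. sg.deg u = k)"
  unfolding regular_graph_def out_degree_eq_deg using graph_axioms by blast

lemma common_neighbors_eq: "common_neighbors G u v = sg.nbs u \<inter> sg.nbs v"
  unfolding common_neighbors_def using adj_in_verts by auto

lemma strongly_regular_iff: "strongly_regular G \<longleftrightarrow> sg.srg"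
  unfolding strongly_regular_def regular_graph_iff sg.srg_def common_neighbors_eq by blast

lemma empty_graph_imp_srg: "empty_graph G \<Longrightarrow> sg.srg"
  by (rule sg.edgeless_imp_srg) (auto simp: empty_graph_def arcs_ends_def)

lemma complete_graph_imp_srg:
  assumes "complete_graph G"
  shows "sg.srg"
proof -
  have ends: "(u, v) \<in> arcs_ends G \<longleftrightarrow> u \<in> verts G \<and> v \<in> verts G \<and> u \<noteq> v" for u v
    using assms unfolding complete_graph_def complete_digraph_def by auto
  have nbs: "sg.nbs u = verts G - {u}" if "u \<in> verts G" for u
    by (rule Set.set_eqI, subst sg.in_nbs, subst ends) (use that in auto)
  have "sg.deg u = card (verts G) - 1" if "u \<in> verts G" for u
    unfolding sg.deg_def nbs[OF that] using that by simp
  moreover have "card (sg.nbs u \<inter> sg.nbs v) = card (verts G) - 2" "v \<in> sg.nbs u"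
    if "u \<in> verts G" "v \<in> verts G" "u \<noteq> v" for u v
  proof -
    have "sg.nbs u \<inter> sg.nbs v = verts G - {u, v}"
      using that by (auto simp: nbs simp del: sg.in_nbs)
    then show "card (sg.nbs u \<inter> sg.nbs v) = card (verts G) - 2"
      using that by (simp add: card_Diff_subset)
    show "v \<in> sg.nbs u"
      using that by (simp add: nbs del: sg.in_nbs)
  qed
  \<comment> \<open>No two distinct vertices are non-adjacent, so the last parameter is an arbitrary
    0.\<close>
  ultimately show ?thesis
    unfolding sg.srg_def
    by (intro exI[of _ "card (verts G) - 1"] exI[of _ "card (verts G) - 2"] exI[of _ 0]) auto
qed

subsection \<open>Eigenvalues\<close>

lemma adjacency_matrix_mult_vec:
  assumes "distinct vs" "set vs = verts G"
  shows "adjacency_matrix G vs *\<^sub>v vec (length vs) (\<lambda>i. f (vs ! i)) =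
    vec (length vs) (\<lambda>i. sg.aop f (vs ! i))"
proof (rule eq_vecI)
  fix i assume "i < dim_vec (vec (length vs) (\<lambda>i. sg.aop f (vs ! i)))"
  then have i: "i < length vs"
    by simp
  have "(adjacency_matrix G vs *\<^sub>v vec (length vs) (\<lambda>i. f (vs ! i))) $ i =
      (\<Sum>j<length vs. if (vs ! i, vs ! j) \<in> arcs_ends G then f (vs ! j) else 0)"
    using i unfolding adjacency_matrix_def
    by (auto simp: scalar_prod_def atLeast0LessThan intro!: sum.cong)
  also have "\<dots> = (\<Sum>w\<in>verts G. if (vs ! i, w) \<in> arcs_ends G then f w else 0)"
    using assms by (intro sum.reindex_bij_betw bij_betw_nth) auto
  also have "\<dots> = sg.aop f (vs ! i)"
    unfolding sg.aop_def sg.sum_nbs ..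
  finally show "(adjacency_matrix G vs *\<^sub>v vec (length vs) (\<lambda>i. f (vs ! i))) $ i =
      vec (length vs) (\<lambda>i. sg.aop f (vs ! i)) $ i"
    using i by simp
qed (simp add: adjacency_matrix_def)

text \<open>The right-hand side does not mention \<open>vs\<close>, so all enumerations have the
  same spectrum.\<close>

lemma eigenvalue_adjacency_matrix_iff:
  assumes vs: "distinct vs" "set vs = verts G"
  shows "eigenvalue (adjacency_matrix G vs) x \<longleftrightarrow> x \<in> sg.eigenvalues"
proof -
  let ?n = "length vs"
  let ?v = "\<lambda>f. vec ?n (\<lambda>i. f (vs ! i))"
  have dim: "dim_row (adjacency_matrix G vs) = ?n"
    by (simp add: adjacency_matrix_def)
  have nz: "?v f = 0\<^sub>v ?n \<longleftrightarrow> (\<forall>u\<in>verts G. f u = 0)" for f :: "'a \<Rightarrow> real"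
    unfolding vs(2)[symmetric] all_set_conv_all_nth by (auto simp: vec_eq_iff)
  have eig: "adjacency_matrix G vs *\<^sub>v ?v f = x \<cdot>\<^sub>v ?v f \<longleftrightarrow> (\<forall>u\<in>verts G. sg.aop f u = x * f u)"
    for f
    unfolding adjacency_matrix_mult_vec[OF vs] vs(2)[symmetric] all_set_conv_all_nth
    by (auto simp: vec_eq_iff)
  \<comment> \<open>Inverting the enumeration, which is injective, turns a vector into a function on
    vertices.\<close>
  have surj: "\<exists>f. w = ?v f" if "w \<in> carrier_vec ?n" for w :: "real vec"
  proof -
    let ?g = "the_inv_into {..<?n} ((!) vs)"
    have "inj_on ((!) vs) {..<?n}"
      using vs(1) by (simp add: inj_on_nth)
    then have "w = ?v (\<lambda>u. w $ ?g u)"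
      using that by (intro eq_vecI) (auto simp: the_inv_into_f_f)
    then show ?thesis
      by (rule exI[of _ "\<lambda>u. w $ ?g u"])
  qed
  show ?thesis
  proof
    assume "eigenvalue (adjacency_matrix G vs) x"
    then obtain w where w: "w \<in> carrier_vec ?n" "w \<noteq> 0\<^sub>v ?n" "adjacency_matrix G vs *\<^sub>v w = x \<cdot>\<^sub>v w"
      unfolding eigenvalue_def eigenvector_def dim by blast
    then obtain f where "w = ?v f"
      using surj by blast
    then show "x \<in> sg.eigenvalues"
      using w nz eig unfolding sg.eigenvalues_def by auto
  next
    assume "x \<in> sg.eigenvalues"
    then obtain f where "\<not> (\<forall>u\<in>verts G. f u = 0)" "\<forall>u\<in>verts G. sg.aop f u = x * f u"
      unfolding sg.eigenvalues_def by blast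
    then have "?v f \<in> carrier_vec ?n \<and> ?v f \<noteq> 0\<^sub>v ?n \<and> adjacency_matrix G vs *\<^sub>v ?v f = x \<cdot>\<^sub>v ?v f"
      unfolding nz eig by simp
    then show "eigenvalue (adjacency_matrix G vs) x"
      unfolding eigenvalue_def eigenvector_def dim
      by (rule exI[of _ "?v f"])
  qed
qed

lemma graph_eigenvalues_eq: "graph_eigenvalues G = sg.eigenvalues"
proof -
  obtain vs where "distinct vs" "set vs = verts G"
    using finite_distinct_list[OF finite_verts] by blast
  then show ?thesis
    unfolding graph_eigenvalues_def using eigenvalue_adjacency_matrix_iff by blast
qed

end

subsection \<open>Disjoint unions of complete bipartite graphs\<close>

lemma complete_bipartite_digraph_edges:
  assumes "verts H = U \<union> W" "U \<inter> W = {}" "arcs_ends H = U \<times> W \<union> W \<times> U"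
  shows "card (edges H) = card U * card W"
proof -
  have "edges H = (\<lambda>(u, w). {u, w}) ` (U \<times> W)"
    unfolding edges_def assms(3) by (auto simp: insert_commute)
  moreover have "inj_on (\<lambda>(u, w). {u, w}) (U \<times> W)"
    using assms(2) by (auto simp: inj_on_def doubleton_eq_iff)
  ultimately show ?thesis
    by (simp add: card_image card_cartesian_product)
qed

context graph
begin

lemma graph_induce_subgraph:
  assumes "S \<subseteq> verts G"
  shows "graph (G \<restriction> S)"
proof -
  have ind: "induced_subgraph (G \<restriction> S) G"
    using induced_induce[OF assms] .
  then have "digraph (G \<restriction> S)"
    using digraph_subgraph induced_imp_subgraph by blast
  then show ?thesis
    using digraph.graphI induced_graph_imp_symmetric[OF sym_arcs ind] by blast
qed

lemma arcs_ends_induce_subgraph: "arcs_ends (G \<restriction> S) = arcs_ends G \<inter> S \<times> S"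
  by (auto simp: arcs_ends_conv)

text \<open>The walks w, z, y, x and w, x, y, z are closed up by an edge.\<close>

lemma P4_closed_nbs_eq:
  assumes "sg.P4_closed" "y \<in> sg.nbs x" "z \<in> sg.nbs y"
  shows "sg.nbs z = sg.nbs x"
proof (rule Set.set_eqI)
  fix w
  show "w \<in> sg.nbs z \<longleftrightarrow> w \<in> sg.nbs x"
    using sg.P4_closedD[OF assms(1), of w z y x] sg.P4_closedD[OF assms(1), of w x y z]
      assms(2,3) sg.adj_commute by auto
qed

text \<open>With a common neighbour \<open>w\<close>, closing up the walk w, y, x, w would produce a
  loop.\<close>

lemma P4_closed_nbs_disjoint:
  assumes "sg.P4_closed" "y \<in> sg.nbs x"
  shows "sg.nbs x \<inter> sg.nbs y = {}"
proof -
  have "w \<notin> sg.nbs y" if "w \<in> sg.nbs x" for w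
  proof
    assume "w \<in> sg.nbs y"
    then show False
      using sg.P4_closedD[OF assms(1), of w y x w] that assms(2) sg.adj_irrefl sg.adj_commute by auto
  qed
  then show ?thesis by blast
qed

text \<open>The vertices at distance at most 2 from \<open>x\<close>. Under \<open>P4_closed\<close>
  this is the connected component, since the ends of a walk of length 3 are adjacent.\<close>

definition component :: "'a \<Rightarrow> 'a set" where
  "component x = insert x (sg.nbs x \<union> (\<Union>y\<in>sg.nbs x. sg.nbs y))"

lemma component_subset: "x \<in> verts G \<Longrightarrow> component x \<subseteq> verts G"
  unfolding component_def using sg.nbs_subset_V by blast

lemma component_isolated: "sg.nbs x = {} \<Longrightarrow> component x = {x}"
  unfolding component_def by auto

lemma component_edge:
  assumes "sg.P4_closed" "y \<in> sg.nbs x"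
  shows "component x = sg.nbs y \<union> sg.nbs x"
proof -
  have "sg.nbs y' = sg.nbs y" if "y' \<in> sg.nbs x" for y'
    using P4_closed_nbs_eq[OF assms(1), of x y y'] assms(2) that sg.adj_commute by auto
  moreover have "x \<in> sg.nbs y"
    using assms(2) sg.adj_commute by auto
  ultimately show ?thesis
    unfolding component_def using assms(2) by blast
qed

text \<open>Makes distinct components disjoint. Moving from \<open>x\<close> to \<open>z\<close> at
  most swaps the two colour classes.\<close>

lemma component_eq:
  assumes "sg.P4_closed" "z \<in> component x"
  shows "component z = component x"
proof (cases "sg.nbs x = {}")
  case True
  then show ?thesis
    using component_isolated assms(2) by simp
next
  case False
  then obtain y where y: "y \<in> sg.nbs x" by blast
  then have xy: "x \<in> sg.nbs y"
    using sg.adj_commute by auto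
  have "z \<in> sg.nbs y \<union> sg.nbs x"
    using component_edge[OF assms(1) y] assms(2) by simp
  then show ?thesis
  proof
    assume z: "z \<in> sg.nbs y"
    then have nbs: "sg.nbs z = sg.nbs x"
      by (rule P4_closed_nbs_eq[OF assms(1) y])
    then have "component z = sg.nbs y \<union> sg.nbs z"
      using y by (intro component_edge[OF assms(1)]) simp
    then show ?thesis
      unfolding nbs component_edge[OF assms(1) y] .
  next
    assume z: "z \<in> sg.nbs x"
    then have nbs: "sg.nbs z = sg.nbs y"
      by (rule P4_closed_nbs_eq[OF assms(1) xy])
    then have "component z = sg.nbs x \<union> sg.nbs z"
      using xy by (intro component_edge[OF assms(1)]) simp
    then show ?thesis
      unfolding nbs component_edge[OF assms(1) y] by blast
  qed
qed

text \<open>Each vertex in one of the classes \<open>nbs y\<close> and \<open>nbs x\<close> has the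
  other class as its neighbourhood; the class sizes are the two degrees.\<close>

lemma component_edge_complete_bipartite:
  assumes "sg.P4_closed" "y \<in> sg.nbs x"
  shows "complete_bipartite (G \<restriction> component x)"
    "card (edges (G \<restriction> component x)) = sg.deg x * sg.deg y"
proof -
  let ?U = "sg.nbs y" and ?W = "sg.nbs x" and ?H = "G \<restriction> component x"
  have xy: "x \<in> sg.nbs y"
    using assms(2) sg.adj_commute by auto
  have disj: "?U \<inter> ?W = {}"
    using P4_closed_nbs_disjoint[OF assms] by blast
  have U: "sg.nbs u = ?W" if "u \<in> ?U" for u
    using P4_closed_nbs_eq[OF assms that] .
  have W: "sg.nbs w = ?U" if "w \<in> ?W" for w
    using P4_closed_nbs_eq[OF assms(1) xy that] .
  have verts: "verts ?H = ?U \<union> ?W"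
    using component_edge[OF assms] by simp
  have ends: "arcs_ends ?H = ?U \<times> ?W \<union> ?W \<times> ?U"
  proof -
    have "(u, w) \<in> arcs_ends G \<longleftrightarrow> w \<in> ?W" if "u \<in> ?U" for u w
      using U[OF that] by auto
    moreover have "(w, u) \<in> arcs_ends G \<longleftrightarrow> u \<in> ?U" if "w \<in> ?W" for u w
      using W[OF that] by auto
    ultimately show ?thesis
      unfolding arcs_ends_induce_subgraph component_edge[OF assms] by blast
  qed
  have "x \<in> verts G"
    using assms(2) sg.adj_in_V by auto
  then have "graph ?H"
    using graph_induce_subgraph component_subset by blast
  then have "complete_bipartite_digraph (sg.deg y) (sg.deg x) ?H"
    unfolding complete_bipartite_digraph_def sg.deg_def using verts disj ends by blast
  moreover have "sg.deg x > 0" "sg.deg y > 0"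
    using assms(2) xy sg.deg_pos by auto
  ultimately show "complete_bipartite ?H"
    unfolding complete_bipartite_def by blast
  show "card (edges ?H) = sg.deg x * sg.deg y"
    using complete_bipartite_digraph_edges[OF verts disj ends] by (simp add: sg.deg_def)
qed

text \<open>The members of the union are the subgraphs induced on the components.\<close>

lemma biclique_union_imp_union_of_complete_bipartite:
  assumes "sg.biclique_union s"
  shows "union_of_equal_size_complete_bipartite G"
proof -
  have P: "sg.P4_closed" and deg: "\<And>u v. v \<in> sg.nbs u \<Longrightarrow> sg.deg u * sg.deg v = s"
    using assms unfolding sg.biclique_union_def by auto
  let ?H = "\<lambda>x. G \<restriction> component x"
  define HH where "HH = ?H ` verts G"
  have self: "x \<in> component x" for x
    unfolding component_def by simp
  have "disjoint_union_of G HH"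
    unfolding disjoint_union_of_def
  proof (intro conjI ballI impI)
    fix H assume "H \<in> HH"
    then show "subgraph H G"
      unfolding HH_def using component_subset induced_imp_subgraph[OF induced_induce] by blast
  next
    fix H K assume "H \<in> HH" "K \<in> HH" "H \<noteq> K"
    obtain x where x: "H = ?H x"
      using \<open>H \<in> HH\<close> unfolding HH_def by blast
    obtain y where y: "K = ?H y"
      using \<open>K \<in> HH\<close> unfolding HH_def by blast
    have "component x \<noteq> component y"
      using \<open>H \<noteq> K\<close> x y by auto
    then have "component x \<inter> component y = {}"
      using component_eq[OF P] by blast
    then show "verts H \<inter> verts K = {}"
      using x y by simp
  next
    show "verts G = (\<Union>H\<in>HH. verts H)"
      unfolding HH_def using self component_subset by auto
  next
    have "e \<in> (\<Union>H\<in>HH. arcs H)" if e: "e \<in> arcs G" for e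
    proof -
      have "(tail G e, head G e) \<in> arcs_ends G"
        using e by (simp add: arcs_ends_conv)
      then have "head G e \<in> component (tail G e)"
        unfolding component_def by simp
      then show ?thesis
        unfolding HH_def using e self by (intro UN_I[of "?H (tail G e)"] imageI) simp_all
    qed
    moreover have "arcs H \<subseteq> arcs G" if "H \<in> HH" for H
      using that unfolding HH_def by auto
    ultimately show "arcs G = (\<Union>H\<in>HH. arcs H)"
      by blast
  qed
  moreover have "(complete_bipartite H \<and> card (edges H) = s) \<or> isolated_vertex H" if "H \<in> HH" for H
  proof -
    obtain x where x: "H = ?H x"
      using \<open>H \<in> HH\<close> unfolding HH_def by blast
    show ?thesis
    proof (cases "sg.nbs x = {}")
      case True
      then have "verts H = {x}"
        unfolding x using component_isolated by simp
      moreover have "arcs H = {}"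
        unfolding x component_isolated[OF True] using no_loops by fastforce
      ultimately show ?thesis
        unfolding isolated_vertex_def by simp
    next
      case False
      then obtain y where "y \<in> sg.nbs x" by blast
      then show ?thesis
        unfolding x using component_edge_complete_bipartite[OF P] deg by simp
    qed
  qed
  ultimately show ?thesis
    unfolding union_of_equal_size_complete_bipartite_def using graph_axioms by blast
qed

text \<open>Members of the union have disjoint vertex sets, so every arc at a vertex of a member
  lies in that member, and its neighbourhoods are those of \<open>G\<close>. A walk of length 3 then
  alternates between the two classes of one member.\<close>

lemma union_of_complete_bipartite_imp_biclique_union:
  assumes "union_of_equal_size_complete_bipartite G"
  shows "\<exists>s. sg.biclique_union s"
proof -
  obtain HH s where HH: "disjoint_union_of G HH"
    and types: "\<And>H. H \<in> HH \<Longrightarrow> (complete_bipartite H \<and> card (edges H) = s) \<or> isolated_vertex H"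
    using assms unfolding union_of_equal_size_complete_bipartite_def by blast
  have sub: "\<forall>H\<in>HH. subgraph H G"
    and disj: "\<forall>H\<in>HH. \<forall>K\<in>HH. H \<noteq> K \<longrightarrow> verts H \<inter> verts K = {}"
    and arcs: "arcs G = (\<Union>H\<in>HH. arcs H)"
    using HH by (simp_all add: disjoint_union_of_def)
  \<comment> \<open>Phrased through neighbourhoods in \<open>G\<close>, so that once
    \<open>part\<close> is proved the decomposition \<open>HH\<close> can be forgotten.\<close>
  define biclique where "biclique U W \<longleftrightarrow>
    card U * card W = s \<and> (\<forall>x\<in>U. sg.nbs x = W) \<and> (\<forall>x\<in>W. sg.nbs x = U)" for U W
  have part: "\<exists>U W. u \<in> U \<and> biclique U W"
    if uv: "(u, v) \<in> arcs_ends G" for u v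
  proof -
    have ends: "\<exists>H\<in>HH. (x, y) \<in> arcs_ends H" if "(x, y) \<in> arcs_ends G" for x y
    proof -
      obtain e where e: "e \<in> arcs G" "tail G e = x" "head G e = y"
        using \<open>(x, y) \<in> arcs_ends G\<close> by blast
      then obtain H where H: "H \<in> HH" "e \<in> arcs H"
        using arcs by auto
      then have "compatible G H"
        using sub by (simp add: subgraph_def)
      then have "(x, y) \<in> arcs_ends H"
        using e H(2) unfolding arcs_ends_conv compatible_def by force
      then show ?thesis
        using H(1) by blast
    qed
    have wf: "wf_digraph H" "arcs_ends H \<subseteq> arcs_ends G" if "H \<in> HH" for H
    proof -
      have "subgraph H G"
        using that sub by simp
      then show "wf_digraph H" "arcs_ends H \<subseteq> arcs_ends G"
        using arcs_ends_mono by (auto simp: subgraph_def)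
    qed
    obtain H where H: "H \<in> HH" "(u, v) \<in> arcs_ends H"
      using ends[OF uv] by blast
    then have "arcs H \<noteq> {}"
      by (auto simp: arcs_ends_conv)
    then have "complete_bipartite H" and s: "card (edges H) = s"
      using types[OF H(1)] unfolding isolated_vertex_def by blast+
    then obtain U W where UW: "verts H = U \<union> W" "U \<inter> W = {}" "arcs_ends H = U \<times> W \<union> W \<times> U"
      unfolding complete_bipartite_def complete_bipartite_digraph_def by blast
    have nbs: "y \<in> sg.nbs x \<longleftrightarrow> (x, y) \<in> arcs_ends H" if "x \<in> verts H" for x y
    proof
      assume "y \<in> sg.nbs x"
      then obtain K where K: "K \<in> HH" "(x, y) \<in> arcs_ends K"
        using ends[of x y] by auto
      then have "x \<in> verts K"
        using wf_digraph.adj_in_verts[OF wf(1)] by blast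
      then have "K = H"
        using that K(1) H(1) disj by blast
      then show "(x, y) \<in> arcs_ends H"
        using K(2) by simp
    next
      assume "(x, y) \<in> arcs_ends H"
      then show "y \<in> sg.nbs x"
        using wf(2)[OF H(1)] by auto
    qed
    have U: "sg.nbs x = W" if "x \<in> U" for x
      by (rule Set.set_eqI) (use nbs[of x] that UW in auto)
    have W: "sg.nbs x = U" if "x \<in> W" for x
      by (rule Set.set_eqI) (use nbs[of x] that UW in auto)
    have "card U * card W = s"
      using complete_bipartite_digraph_edges[OF UW] s by simp
    then have bc: "biclique U W" "biclique W U"
      unfolding biclique_def using U W by (simp_all add: mult.commute)
    have "u \<in> U \<or> u \<in> W"
      using H(2) UW(3) by blast
    then show ?thesis
    proof
      assume "u \<in> U"
      then show ?thesis
        by (intro exI[of _ U] exI[of _ W] conjI bc(1))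
    next
      assume "u \<in> W"
      then show ?thesis
        by (intro exI[of _ W] exI[of _ U] conjI bc(2))
    qed
  qed
  have P: "(u, w) \<in> arcs_ends G"
    if path: "(u, x) \<in> arcs_ends G" "(x, v) \<in> arcs_ends G" "(v, w) \<in> arcs_ends G" for u x v w
  proof -
    obtain U W where u: "u \<in> U" and UW: "biclique U W"
      using part[OF path(1)] by blast
    have U: "sg.nbs x = W" if "x \<in> U" for x
      using UW that unfolding biclique_def by simp
    have W: "sg.nbs x = U" if "x \<in> W" for x
      using UW that unfolding biclique_def by simp
    have "x \<in> W" using path(1) U[OF u] by auto
    have "v \<in> U" using path(2) W[OF \<open>x \<in> W\<close>] by auto
    have "w \<in> W" using path(3) U[OF \<open>v \<in> U\<close>] by auto
    then show ?thesis using U[OF u] by auto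
  qed
  have D: "sg.deg u * sg.deg v = s" if uv: "(u, v) \<in> arcs_ends G" for u v
  proof -
    obtain U W where u: "u \<in> U" and UW: "biclique U W"
      using part[OF uv] by blast
    have U: "sg.nbs u = W"
      using UW u unfolding biclique_def by simp
    then have "v \<in> W"
      using uv by auto
    then have W: "sg.nbs v = U"
      using UW unfolding biclique_def by blast
    have "card U * card W = s"
      using UW unfolding biclique_def by blast
    then show ?thesis
      unfolding sg.deg_def U W by (simp only: mult.commute)
  qed
  have "sg.P4_closed"
    unfolding sg.P4_closed_def by (intro allI impI, rule P; assumption)
  then have "sg.biclique_union s"
    unfolding sg.biclique_union_def using D by simp
  then show ?thesis ..
qed

end

theorem mainTheorem1:
  fixes G :: "('a, 'b) pre_digraph"
  assumes "graph G" and "verts G \<noteq> {}"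
  shows "((\<exists>l>1. strongly_walk_regular l G) \<longrightarrow>
            empty_graph G \<or> complete_graph G \<or> strongly_regular G \<or>
            union_of_equal_size_complete_bipartite G \<or> regular_with_four_eigenvalues G) \<and>
         (empty_graph G \<or> complete_graph G \<or> strongly_regular G \<longrightarrow>
            (\<forall>l>1. strongly_walk_regular l G)) \<and>
         (union_of_equal_size_complete_bipartite G \<longrightarrow>
            (\<forall>l>1. odd l \<longrightarrow> strongly_walk_regular l G))"
proof -
  interpret graph G by fact
  have "strongly_regular G \<or> union_of_equal_size_complete_bipartite G \<or> regular_with_four_eigenvalues G"
    if "l > 1" "strongly_walk_regular l G" for l
  proof -
    have "\<exists>lam mu nu. sg.swr l lam mu nu"
      using that(2) unfolding strongly_walk_regular_iff by simp
    then obtain lam mu nu where "sg.swr l lam mu nu"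
      by (elim exE)
    then have "sg.srg \<or> (\<exists>s. sg.biclique_union s) \<or>
        ((\<exists>k. \<forall>u\<in>verts G. sg.deg u = k) \<and> card sg.eigenvalues = 4)"
      using \<open>l > 1\<close> assms(2) by (rule sg.swr_classification)
    then show ?thesis
      using strongly_regular_iff biclique_union_imp_union_of_complete_bipartite
      unfolding regular_with_four_eigenvalues_def regular_graph_iff graph_eigenvalues_eq
      by (elim disjE exE) simp_all
  qed
  \<comment> \<open>Empty and complete graphs enter through strong regularity.\<close>
  moreover have "strongly_walk_regular l G"
    if "empty_graph G \<or> complete_graph G \<or> strongly_regular G" "l > 1" for l
    using that empty_graph_imp_srg complete_graph_imp_srg sg.srg_imp_swr[of l]
    unfolding strongly_regular_iff strongly_walk_regular_iff by auto
  moreover have "strongly_walk_regular l G"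
    if "union_of_equal_size_complete_bipartite G" "l > 1" "odd l" for l
  proof -
    obtain s where "sg.biclique_union s"
      using union_of_complete_bipartite_imp_biclique_union[OF \<open>union_of_equal_size_complete_bipartite G\<close>] ..
    then show ?thesis
      using sg.biclique_union_imp_swr[OF _ \<open>odd l\<close>] \<open>l > 1\<close>
      unfolding strongly_walk_regular_iff by auto
  qed
  ultimately show ?thesis
    by blast
qed

end
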